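(* Let $G=(V,E)$ be a connected graph, let $K\in\mathbb{N}$, and fix distinct edges $e_1=\{u_1,v_1\},\dots,e_K=\{u_K,v_K\}\in E$. Let $\vec{\mathbb{G}}=(\mathbb{V},\vec{\mathbb{E}})$ be the associated oriented ladder graph, and for $\mathbf{q}\in(0,1)^{K}$ let $\vec{p}_c(\mathbf{q})=\sup\{p\in[0,1]:\vec{\mathbb{P}}_{\mathbf{q},p}(\vec{C}_\infty)=0\}$ be the critical parameter of the inhomogeneous oriented percolation model on $\vec{\mathbb{G}}$ with distinguished columns given by $e_1,\dots,e_K$. Then the function $\mathbf{q}\mapsto\vec{p}_c(\mathbf{q})$ is continuous on $(0,1)^{K}$.
   Context: Given a connected (unoriented) graph $G=(V,E)$, the oriented ladder graph $\vec{\mathbb{G}}=(\mathbb{V},\vec{\mathbb{E}})$ has vertex set $\mathbb{V}=V\times\mathbb{Z}$ and set of oriented edges $$\vec{\mathbb{E}}=\{\langle(u,n),(v,n+1)\rangle:\{u,v\}\in E,\ n\in\mathbb{Z}\},$$ where $\langle a,b\rangle$ denotes an edge oriented from $a$ to $b$ (each $\{u,v\}\in E$ yields both $\langle(u,n),(v,n+1)\rangle$ and $\langle(v,n),(u,n+1)\rangle$). A percolation configuration is an element $\omega\in\{0,1\}^{\vec{\mathbb{E}}}$; the edge $e$ is open if $\omega(e)=1$ and closed if $\omega(e)=0$. An open path is a sequence of distinct vertices in which each vertex is joined to the next by an open oriented edge, followed in its direction. The forward cluster of a vertex is the set of vertices equal to it or reachable from it by an open path. $\vec{C}_\infty$ is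 the event that there is an infinite forward cluster in $\vec{\mathbb{G}}$. For the fixed edges $e_i=\{u_i,v_i\}$ ($1\le i\le K$), define $$\vec{\mathbb{E}}^i=\{\langle(u_i,n),(v_i,n+1)\rangle,\ \langle(v_i,n),(u_i,n+1)\rangle:n\in\mathbb{Z}\}.$$ For $\mathbf{q}=(q_1,\dots,q_K)\in(0,1)^K$ and $p\in[0,1]$, $\vec{\mathbb{P}}_{\mathbf{q},p}$ is the law on $\{0,1\}^{\vec{\mathbb{E}}}$ under which the edges are independent, each edge of $\vec{\mathbb{E}}^i$ is open with probability $q_i$ ($1\le i\le K$), and each edge of $\vec{\mathbb{E}}\setminus\bigcup_{i=1}^{K}\vec{\mathbb{E}}^i$ is open with probability $p$. *)

theory Defs
  imports "HOL-Probability.Probability"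
begin

text \<open>
  Simple graphs: edges are two-element sets of vertices. No finiteness, local finiteness or
  countability is required.
\<close>

definition connected_graph :: "'a set \<Rightarrow> 'a set set \<Rightarrow> bool" where
  "connected_graph V E \<longleftrightarrow>
     V \<noteq> {} \<and>
     (\<forall>e\<in>E. \<exists>u\<in>V. \<exists>v\<in>V. u \<noteq> v \<and> e = {u, v}) \<and>
     (\<forall>u\<in>V. \<forall>v\<in>V. (u, v) \<in> {(x, y). {x, y} \<in> E}\<^sup>*)"

type_synonym 'a ladder_vertex = "'a \<times> int"
type_synonym 'a ladder_edge = "'a ladder_vertex \<times> 'a ladder_vertex"

text \<open>The pair \<open>(a, b)\<close> is the edge oriented from \<open>a\<close> to \<open>b\<close>.\<close>

definition ladder_vertices :: "'a set \<Rightarrow> 'a ladder_vertex set" where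
  "ladder_vertices V = V \<times> UNIV"

definition ladder_edges :: "'a set set \<Rightarrow> 'a ladder_edge set" where
  "ladder_edges E = {((u, n), (v, n + 1)) | u v n. {u, v} \<in> E}"

definition ladder_column :: "'a \<Rightarrow> 'a \<Rightarrow> 'a ladder_edge set" where
  "ladder_column u v = (\<Union>n. {((u, n), (v, n + 1)), ((v, n), (u, n + 1))})"

text \<open>
  A configuration assigns \<open>True\<close> to the open and \<open>False\<close> to the closed edges. The clause
  \<open>xs \<noteq> []\<close> makes \<open>hd\<close> and \<open>last\<close> below meaningful; one-vertex paths are allowed.
\<close>

definition open_path :: "'a set \<Rightarrow> 'a set set \<Rightarrow> ('a ladder_edge \<Rightarrow> bool) \<Rightarrow> 'a ladder_vertex list \<Rightarrow> bool"
  where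
  "open_path V E \<omega> xs \<longleftrightarrow>
     xs \<noteq> [] \<and> set xs \<subseteq> ladder_vertices V \<and> distinct xs \<and>
     successively (\<lambda>a b. (a, b) \<in> ladder_edges E \<and> \<omega> (a, b)) xs"

definition forward_cluster ::
  "'a set \<Rightarrow> 'a set set \<Rightarrow> ('a ladder_edge \<Rightarrow> bool) \<Rightarrow> 'a ladder_vertex \<Rightarrow> 'a ladder_vertex set" where
  "forward_cluster V E \<omega> a =
     {b. b = a \<or> (\<exists>xs. open_path V E \<omega> xs \<and> hd xs = a \<and> last xs = b)}"

definition infinite_cluster_event :: "'a set \<Rightarrow> 'a set set \<Rightarrow> ('a ladder_edge \<Rightarrow> bool) set" where
  "infinite_cluster_event V E =
     {\<omega> \<in> ladder_edges E \<rightarrow>\<^sub>E UNIV. \<exists>a\<in>ladder_vertices V. infinite (forward_cluster V E \<omega> a)}"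

text \<open>
  The distinguished edges are \<open>{u i, v i}\<close> for \<open>i :: 'k\<close>, so their number is \<open>CARD('k)\<close>. When these
  edges are pairwise distinct their columns are pairwise disjoint, so the index chosen by \<open>THE\<close> is
  well defined.
\<close>

definition edge_prob ::
  "('k::finite \<Rightarrow> 'a) \<Rightarrow> ('k \<Rightarrow> 'a) \<Rightarrow> real ^ 'k \<Rightarrow> real \<Rightarrow> 'a ladder_edge \<Rightarrow> real" where
  "edge_prob u v q p e =
     (if \<exists>i. e \<in> ladder_column (u i) (v i) then q $ (THE i. e \<in> ladder_column (u i) (v i)) else p)"

definition percolation_measure ::
  "'a set set \<Rightarrow> ('k::finite \<Rightarrow> 'a) \<Rightarrow> ('k \<Rightarrow> 'a) \<Rightarrow> real ^ 'k \<Rightarrow> real \<Rightarrow> ('a ladder_edge \<Rightarrow> bool) measure"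
  where
  "percolation_measure E u v q p =
     (\<Pi>\<^sub>M e\<in>ladder_edges E. measure_pmf (bernoulli_pmf (edge_prob u v q p e)))"

text \<open>
  Membership in \<open>null_sets\<close> says that the event is measurable and has probability zero; it is
  measurable whenever \<open>V\<close> is countable. The formulation \<open>measure M A = 0\<close> would also hold for
  every non-measurable \<open>A\<close>.
\<close>

definition critical_prob ::
  "'a set \<Rightarrow> 'a set set \<Rightarrow> ('k::finite \<Rightarrow> 'a) \<Rightarrow> ('k \<Rightarrow> 'a) \<Rightarrow> real ^ 'k \<Rightarrow> real" where
  "critical_prob V E u v q =
     Sup {p \<in> {0..1}. infinite_cluster_event V E \<in> null_sets (percolation_measure E u v q p)}"

end

theory Submission
  imports Defs
begin

text \<open>
  It is enough to show that raising \<open>p\<close> a little compensates for small changes of the column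
  parameters: for \<open>0 < p < p' \<le> 1\<close> there is a \<open>d > 0\<close> such that, for all \<open>q1\<close> and \<open>q2\<close> within \<open>d\<close> of
  \<open>q\<close> in every coordinate, percolation from a vertex is at least as likely under \<open>(q1, p')\<close> as under
  \<open>(q2, p)\<close> (\<open>percolates_comparison\<close>). Continuity then follows by squeezing (\<open>critical_prob_continuous_at\<close>).

  For an infinite, locally finite graph, cut the levels into windows of constant length and let a block
  consist of all edges in a window that project to an edge with an endpoint on a distinguished edge. A
  block is finite, and blocks are translates of each other. Change the parameters block by block,
  conditioning on everything outside the block (\<open>event_prob_blockwise_mono\<close>). Then only an increasing event on a finite set of edges remains: reaching
  a far level, as a function of the configuration in the block. A function that is not constant must
  have a pivotal edge outside the distinguished columns (\<open>block_dichotomy\<close>). The reason is that a path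
  crossing the block inside the columns can avoid them at one prescribed level: it makes a detour of
  two steps along an undistinguished edge, which exists because the graph is infinite and connected
  (\<open>rerouting\<close>). The coordinates of \<open>q\<close> and \<open>p\<close> lie strictly between \<open>0\<close> and \<open>1\<close>, so raising \<open>p\<close>
  strictly increases the probability of a nonconstant event. As there are finitely many events on a block, some \<open>d > 0\<close> is good
  for all of them (\<open>block_domination\<close>).

  In the remaining cases the critical parameter is constant. If the event of percolation is not
  measurable, which can only happen for uncountable graphs, it is a supremum over the empty set.
  Otherwise it is \<open>1\<close> if the graph is finite, since closed levels stop every path, and \<open>0\<close> if some
  vertex has infinite degree.
\<close>

section \<open>Events of finitely many independent edges\<close>

text \<open>
  Probabilities on finitely many independent edges. A configuration on \<open>J\<close> is the set
  \<open>S \<subseteq> J\<close> of its open edges; \<open>r e\<close> is the probability that \<open>e\<close> is open, \<open>config_weight\<close> is the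
  probability of \<open>S\<close>, and \<open>event_prob\<close> that of the event \<open>A\<close>.
\<close>

definition config_weight :: "('e \<Rightarrow> real) \<Rightarrow> 'e set \<Rightarrow> 'e set \<Rightarrow> real" where
  "config_weight r J S = (\<Prod>e\<in>J. if e \<in> S then r e else 1 - r e)"

definition event_prob :: "('e \<Rightarrow> real) \<Rightarrow> 'e set \<Rightarrow> ('e set \<Rightarrow> bool) \<Rightarrow> real" where
  "event_prob r J A = (\<Sum>S\<in>Pow J. of_bool (A S) * config_weight r J S)"

lemma config_weight_nonneg:
  assumes "\<And>e. e \<in> J \<Longrightarrow> 0 \<le> r e \<and> r e \<le> 1"
  shows "0 \<le> config_weight r J S"
  unfolding config_weight_def using assms by (intro prod_nonneg) auto

lemma config_weight_pos:
  assumes "\<And>e. e \<in> J \<Longrightarrow> 0 < r e \<and> r e < 1"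
  shows "0 < config_weight r J S"
  unfolding config_weight_def using assms by (intro prod_pos) auto

lemma config_weight_Un:
  assumes "finite F" "finite J" "F \<inter> J = {}" "S \<subseteq> F" "S' \<subseteq> J"
  shows "config_weight r (F \<union> J) (S \<union> S') = config_weight r F S * config_weight r J S'"
proof -
  have "config_weight r (F \<union> J) (S \<union> S') =
      config_weight r F (S \<union> S') * config_weight r J (S \<union> S')"
    unfolding config_weight_def using assms(1-3) by (rule prod.union_disjoint)
  also have "config_weight r F (S \<union> S') = config_weight r F S"
    unfolding config_weight_def using assms(3-5) by (intro prod.cong) auto
  also have "config_weight r J (S \<union> S') = config_weight r J S'"
    unfolding config_weight_def using assms(3-5) by (intro prod.cong) auto
  finally show ?thesis .
qed

text \<open>Conditioning on the part of the configuration that lies in \<open>J\<close>.\<close>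

lemma event_prob_Un:
  assumes "finite F" "finite J" "F \<inter> J = {}"
  shows "event_prob r (F \<union> J) A =
    (\<Sum>S'\<in>Pow J. config_weight r J S' * event_prob r F (\<lambda>S. A (S \<union> S')))"
proof -
  have "event_prob r (F \<union> J) A =
      (\<Sum>(S, S')\<in>Pow F \<times> Pow J. of_bool (A (S \<union> S')) * config_weight r (F \<union> J) (S \<union> S'))"
    unfolding event_prob_def
    by (rule sum.reindex_bij_witness[where i = "\<lambda>(S, S'). S \<union> S'" and j = "\<lambda>S. (S \<inter> F, S \<inter> J)"])
       (use assms(3) in \<open>auto simp: Int_Un_distrib[symmetric] Int_absorb2\<close>)
  also have "\<dots> = (\<Sum>(S, S')\<in>Pow F \<times> Pow J.
      config_weight r J S' * (of_bool (A (S \<union> S')) * config_weight r F S))"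
    using assms by (intro sum.cong) (auto simp: config_weight_Un)
  also have "\<dots> = (\<Sum>S\<in>Pow F. \<Sum>S'\<in>Pow J.
      config_weight r J S' * (of_bool (A (S \<union> S')) * config_weight r F S))"
    by (simp add: sum.cartesian_product)
  also have "\<dots> = (\<Sum>S'\<in>Pow J. \<Sum>S\<in>Pow F.
      config_weight r J S' * (of_bool (A (S \<union> S')) * config_weight r F S))"
    by (rule sum.swap)
  finally show ?thesis
    by (simp add: event_prob_def sum_distrib_left)
qed

lemma event_prob_cong:
  assumes "\<And>e. e \<in> J \<Longrightarrow> r e = r' e" "\<And>S. S \<subseteq> J \<Longrightarrow> A S = A' S"
  shows "event_prob r J A = event_prob r' J A'"
  unfolding event_prob_def config_weight_def
  using assms by (intro sum.cong arg_cong2[where f = "(*)"] prod.cong) auto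

lemma event_prob_empty [simp]: "event_prob r {} A = of_bool (A {})"
  by (simp add: event_prob_def config_weight_def)

lemma event_prob_insert:
  assumes "finite J" "g \<notin> J"
  shows "event_prob r (insert g J) A =
    r g * event_prob r J (\<lambda>S. A (insert g S)) + (1 - r g) * event_prob r J A"
proof -
  have 1: "event_prob r {g} A = r g * of_bool (A {g}) + (1 - r g) * of_bool (A {})" for A
    by (simp add: event_prob_def config_weight_def Pow_insert)
  have "event_prob r ({g} \<union> J) A =
      (\<Sum>S'\<in>Pow J. config_weight r J S' * event_prob r {g} (\<lambda>S. A (S \<union> S')))"
    using assms by (intro event_prob_Un) auto
  then show ?thesis
    unfolding 1 by (simp add: event_prob_def sum_distrib_left sum.distrib[symmetric] algebra_simps)
qed

lemma event_prob_const [simp]: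
  assumes "finite J"
  shows "event_prob r J (\<lambda>_. b) = of_bool b"
  using assms by (induction rule: finite_induct) (auto simp: event_prob_insert algebra_simps)

lemma event_prob_nonneg:
  assumes "\<And>e. e \<in> J \<Longrightarrow> 0 \<le> r e \<and> r e \<le> 1"
  shows "0 \<le> event_prob r J A"
  unfolding event_prob_def by (intro sum_nonneg mult_nonneg_nonneg config_weight_nonneg assms) auto

lemma event_prob_mono_event:
  assumes "\<And>e. e \<in> J \<Longrightarrow> 0 \<le> r e \<and> r e \<le> 1" "\<And>S. S \<subseteq> J \<Longrightarrow> A S \<Longrightarrow> B S"
  shows "event_prob r J A \<le> event_prob r J B"
  unfolding event_prob_def
  by (intro sum_mono mult_right_mono config_weight_nonneg assms(1)) (use assms(2) in auto)

lemma event_prob_not: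
  assumes "finite J"
  shows "event_prob r J (\<lambda>S. \<not> A S) = 1 - event_prob r J A"
proof -
  have "event_prob r J A + event_prob r J (\<lambda>S. \<not> A S) = event_prob r J (\<lambda>_. True)"
    unfolding event_prob_def sum.distrib[symmetric] by (intro sum.cong) auto
  then show ?thesis using assms by simp
qed

lemma mono_eventD: "mono A \<Longrightarrow> S \<subseteq> S' \<Longrightarrow> A S \<Longrightarrow> A S'"
  for A :: "'e set \<Rightarrow> bool"
  unfolding mono_def le_bool_def by blast

lemma event_prob_mono:
  assumes "finite J" "\<And>e. e \<in> J \<Longrightarrow> 0 \<le> r e \<and> r e \<le> r' e \<and> r' e \<le> 1" "mono A"
  shows "event_prob r J A \<le> event_prob r' J A"
  using assms
proof (induction J arbitrary: A rule: finite_induct)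
  case (insert g J)
  let ?B = "\<lambda>S. A (insert g S)"
  have mB: "mono ?B"
    by (intro monoI le_boolI, erule mono_eventD[OF insert.prems(2), rotated]) auto
  have 1: "event_prob r J A \<le> event_prob r' J A" "event_prob r J ?B \<le> event_prob r' J ?B"
    using insert.IH[OF _ insert.prems(2)] insert.IH[OF _ mB] insert.prems(1) by blast+
  have 2: "event_prob r' J A \<le> event_prob r' J ?B"
    by (rule event_prob_mono_event)
       (use insert.prems(1) in force, use mono_eventD[OF insert.prems(2) subset_insertI] in blast)
  have g: "0 \<le> r g" "r g \<le> r' g" "r' g \<le> 1" using insert.prems by auto
  have "r g * event_prob r J ?B + (1 - r g) * event_prob r J A
      \<le> r g * event_prob r' J ?B + (1 - r g) * event_prob r' J A"
    by (intro add_mono mult_left_mono 1) (use g in auto)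
  also have "\<dots> \<le> r' g * event_prob r' J ?B + (1 - r' g) * event_prob r' J A"
  proof -
    have "0 \<le> (r' g - r g) * (event_prob r' J ?B - event_prob r' J A)"
      by (intro mult_nonneg_nonneg) (use g 2 in auto)
    then show ?thesis by (simp add: algebra_simps)
  qed
  finally show ?case using insert.hyps by (simp add: event_prob_insert)
qed simp

text \<open>Strict monotonicity, as soon as \<open>g\<close> is pivotal for \<open>A\<close> in some configuration \<open>S\<close>.\<close>

lemma event_prob_strict_mono:
  assumes fin: "finite J"
    and r: "\<And>e. e \<in> J \<Longrightarrow> 0 < r e \<and> r e < 1 \<and> r e \<le> r' e \<and> r' e \<le> 1"
    and A: "mono A"
    and g: "g \<in> J" "r g < r' g" and S: "S \<subseteq> J" "\<not> A S" "A (insert g S)"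
  shows "event_prob r J A < event_prob r' J A"
proof -
  let ?J = "J - {g}" and ?B = "\<lambda>S. A (insert g S)"
  have J: "J = insert g ?J" "finite ?J" "g \<notin> ?J" using g fin by auto
  have gS: "g \<notin> S" using S by (auto simp: insert_absorb)
  have less: "event_prob r ?J A < event_prob r ?J ?B"
    unfolding event_prob_def
  proof (rule sum_strict_mono_ex1)
    show "finite (Pow ?J)" using fin by simp
    show "\<forall>S\<in>Pow ?J. of_bool (A S) * config_weight r ?J S \<le> of_bool (?B S) * config_weight r ?J S"
    proof (intro ballI mult_right_mono config_weight_nonneg)
      show "of_bool (A S) \<le> (of_bool (?B S) :: real)" for S
        using mono_eventD[OF A subset_insertI, of S g] by auto
    qed (use r in \<open>auto simp: less_imp_le\<close>)
    have "0 < config_weight r ?J S" using r by (intro config_weight_pos) auto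
    then show "\<exists>S\<in>Pow ?J. of_bool (A S) * config_weight r ?J S < of_bool (?B S) * config_weight r ?J S"
      using S gS by (intro bexI[of _ S]) auto
  qed
  have "event_prob r J A = event_prob r (insert g ?J) A" using J by simp
  also have "\<dots> = r g * event_prob r ?J ?B + (1 - r g) * event_prob r ?J A"
    using J by (intro event_prob_insert) auto
  also have "\<dots> < r' g * event_prob r ?J ?B + (1 - r' g) * event_prob r ?J A"
  proof -
    have "0 < (r' g - r g) * (event_prob r ?J ?B - event_prob r ?J A)"
      using less g by (intro mult_pos_pos) auto
    then show ?thesis by (simp add: algebra_simps)
  qed
  also have "\<dots> = event_prob (r(g := r' g)) (insert g ?J) A"
  proof -
    have "event_prob (r(g := r' g)) ?J X = event_prob r ?J X" for X
      by (rule event_prob_cong) auto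
    then show ?thesis using event_prob_insert[OF J(2,3), of "r(g := r' g)" A] by simp
  qed
  also have "\<dots> = event_prob (r(g := r' g)) J A" using J by simp
  also have "\<dots> \<le> event_prob r' J A"
  proof (rule event_prob_mono[OF fin _ A])
    fix e assume "e \<in> J"
    then show "0 \<le> (r(g := r' g)) e \<and> (r(g := r' g)) e \<le> r' e \<and> r' e \<le> 1"
      using r[of e] by auto
  qed
  finally show ?thesis .
qed

lemma event_prob_image:
  assumes "finite J" "inj_on h J"
  shows "event_prob r (h ` J) A = event_prob (r \<circ> h) J (\<lambda>S. A (h ` S))"
  using assms
proof (induction J arbitrary: A rule: finite_induct)
  case (insert g J)
  then have "h g \<notin> h ` J" "inj_on h J" by auto
  with insert show ?case by (simp add: event_prob_insert)
qed simp

lemma continuous_event_prob: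
  fixes r :: "real \<Rightarrow> 'e \<Rightarrow> real"
  assumes "\<And>e. e \<in> J \<Longrightarrow> ((\<lambda>d. r d e) \<longlongrightarrow> r0 e) F"
  shows "((\<lambda>d. event_prob (r d) J A) \<longlongrightarrow> event_prob r0 J A) F"
  unfolding event_prob_def config_weight_def
  using assms by (auto intro!: tendsto_intros)

text \<open>Independence over the disjoint sets \<open>F j\<close>: the bounds for the single events \<open>A j\<close> multiply.\<close>

lemma event_prob_blocks_le:
  fixes F :: "nat \<Rightarrow> 'e set"
  assumes fin: "\<And>j. finite (F j)" and disj: "\<And>i j. i \<noteq> j \<Longrightarrow> F i \<inter> F j = {}"
    and r: "\<And>j e. e \<in> F j \<Longrightarrow> 0 \<le> r e \<and> r e \<le> 1"
    and c: "\<And>j. event_prob r (F j) (A j) \<le> c" and "0 \<le> c"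
  shows "event_prob r (\<Union>j<L. F j) (\<lambda>S. \<forall>j<L. A j (S \<inter> F j)) \<le> c ^ L"
proof (induction L)
  case (Suc L)
  let ?J = "\<Union>j<L. F j"
  let ?B = "\<lambda>S. \<forall>j<L. A j (S \<inter> F j)"
  have dJ: "F L \<inter> ?J = {}" using disj by (simp add: Int_UN_distrib)
  have "event_prob r (\<Union>j<Suc L. F j) (\<lambda>S. \<forall>j<Suc L. A j (S \<inter> F j))
      = event_prob r (F L \<union> ?J) (\<lambda>S. \<forall>j<Suc L. A j (S \<inter> F j))"
    by (simp add: lessThan_Suc)
  also have "\<dots> = (\<Sum>S'\<in>Pow ?J. config_weight r ?J S' *
      event_prob r (F L) (\<lambda>S. \<forall>j<Suc L. A j ((S \<union> S') \<inter> F j)))"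
    using fin dJ by (intro event_prob_Un) auto
  also have "\<dots> = (\<Sum>S'\<in>Pow ?J. config_weight r ?J S' * (of_bool (?B S') * event_prob r (F L) (A L)))"
  proof (intro sum.cong refl arg_cong2[where f = "(*)"])
    fix S' assume S': "S' \<in> Pow ?J"
    have "event_prob r (F L) (\<lambda>S. \<forall>j<Suc L. A j ((S \<union> S') \<inter> F j))
        = event_prob r (F L) (\<lambda>S. A L S \<and> ?B S')"
    proof (rule event_prob_cong[OF refl])
      fix S assume S: "S \<subseteq> F L"
      have "(S \<union> S') \<inter> F L = S" using S S' dJ by auto
      moreover have "(S \<union> S') \<inter> F j = S' \<inter> F j" if "j < L" for j
        using S disj[of j L] that by blast
      ultimately show "(\<forall>j<Suc L. A j ((S \<union> S') \<inter> F j)) = (A L S \<and> ?B S')"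
        unfolding All_less_Suc by metis
    qed
    also have "\<dots> = of_bool (?B S') * event_prob r (F L) (A L)"
      by (cases "?B S'") (simp_all only: event_prob_def, simp_all)
    finally show "event_prob r (F L) (\<lambda>S. \<forall>j<Suc L. A j ((S \<union> S') \<inter> F j))
        = of_bool (?B S') * event_prob r (F L) (A L)" .
  qed
  also have "\<dots> = event_prob r (F L) (A L) * event_prob r ?J ?B"
    by (simp add: event_prob_def sum_distrib_left mult_ac)
  also have "\<dots> \<le> c * c ^ L"
    using c Suc \<open>0 \<le> c\<close> r by (intro mult_mono event_prob_nonneg) auto
  finally show ?case by simp
qed simp

text \<open>
  The joint law of independent edges, indexed by \<open>I\<close>, of which \<open>e\<close> is open with probability \<open>r e\<close>.
\<close>

abbreviation bernoulli_product :: "'e set \<Rightarrow> ('e \<Rightarrow> real) \<Rightarrow> ('e \<Rightarrow> bool) measure" where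
  "bernoulli_product I r \<equiv> \<Pi>\<^sub>M e\<in>I. measure_pmf (bernoulli_pmf (r e))"

text \<open>
  The link between the product measure on all edges of \<open>I\<close>, possibly uncountably many, and the
  finite sums above.
\<close>

lemma cylinder:
  assumes J: "finite J" "J \<subseteq> I" and r: "\<And>e. e \<in> J \<Longrightarrow> 0 \<le> r e \<and> r e \<le> 1"
  shows sets_cylinder: "{\<omega> \<in> I \<rightarrow>\<^sub>E UNIV. A {e \<in> J. \<omega> e}} \<in> sets (bernoulli_product I r)" (is "?C \<in> _")
    and measure_cylinder: "measure (bernoulli_product I r) {\<omega> \<in> I \<rightarrow>\<^sub>E UNIV. A {e \<in> J. \<omega> e}}
      = event_prob r J A"
proof -
  interpret product_prob_space "\<lambda>e. measure_pmf (bernoulli_pmf (r e))" I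
    by (intro product_prob_spaceI prob_space_measure_pmf)
  let ?M = "bernoulli_product I r"
  define C where "C S = prod_emb I (\<lambda>e. measure_pmf (bernoulli_pmf (r e))) J (\<Pi>\<^sub>E e\<in>J. {e \<in> S})" for S
  have C: "C S \<in> sets ?M" "emeasure ?M (C S) = (\<Prod>e\<in>J. emeasure (measure_pmf (bernoulli_pmf (r e))) {e \<in> S})" for S
    unfolding C_def using J by (intro sets_PiM_I emeasure_PiM_emb; simp)+
  have memC: "\<omega> \<in> C S \<longleftrightarrow> \<omega> \<in> I \<rightarrow>\<^sub>E UNIV \<and> (\<forall>e\<in>J. \<omega> e \<longleftrightarrow> e \<in> S)" for \<omega> S
    unfolding C_def prod_emb_def by (simp add: PiE_iff) blast
  have C_unique: "{e \<in> J. \<omega> e} = S" if "\<omega> \<in> C S" "S \<subseteq> J" for \<omega> S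
    using that unfolding memC by blast
  have eq: "?C = (\<Union>S\<in>{S \<in> Pow J. A S}. C S)"
  proof (intro set_eqI iffI)
    fix \<omega> assume \<omega>: "\<omega> \<in> ?C"
    then have "\<omega> \<in> C {e \<in> J. \<omega> e}" unfolding memC by simp
    moreover have "{e \<in> J. \<omega> e} \<in> {S \<in> Pow J. A S}" using \<omega> by simp
    ultimately show "\<omega> \<in> (\<Union>S\<in>{S \<in> Pow J. A S}. C S)" by (rule UN_I[rotated])
  next
    fix \<omega> assume "\<omega> \<in> (\<Union>S\<in>{S \<in> Pow J. A S}. C S)"
    then obtain S where S: "S \<subseteq> J" "A S" "\<omega> \<in> C S" by simp metis
    have "\<omega> \<in> I \<rightarrow>\<^sub>E UNIV" using S(3) unfolding memC by (rule conjunct1)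
    moreover have "A {e \<in> J. \<omega> e}" unfolding C_unique[OF S(3,1)] by (rule S(2))
    ultimately show "\<omega> \<in> ?C" by (intro CollectI conjI)
  qed
  show "?C \<in> sets ?M" unfolding eq using J C(1) by (intro sets.finite_UN) auto
  have mC: "measure ?M (C S) = config_weight r J S" for S
  proof -
    have "emeasure ?M (C S) = (\<Prod>e\<in>J. ennreal (if e \<in> S then r e else 1 - r e))"
      unfolding C(2) using r by (intro prod.cong refl) (simp add: emeasure_pmf_single)
    also have "\<dots> = ennreal (config_weight r J S)"
      unfolding config_weight_def by (rule prod_ennreal) (use r in auto)
    finally show ?thesis
      unfolding measure_def by (simp only:, intro enn2real_ennreal config_weight_nonneg r)
  qed
  have "disjoint_family_on C {S \<in> Pow J. A S}"
  proof (unfold disjoint_family_on_def, intro ballI impI)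
    fix S S' assume SS: "S \<in> {S \<in> Pow J. A S}" "S' \<in> {S \<in> Pow J. A S}" "S \<noteq> S'"
    then have "S \<subseteq> J" "S' \<subseteq> J" by simp_all
    with SS(3) C_unique show "C S \<inter> C S' = {}" by blast
  qed
  then have "measure ?M ?C = (\<Sum>S\<in>{S \<in> Pow J. A S}. measure ?M (C S))"
    unfolding eq using J C(1) by (intro finite_measure_finite_Union) auto
  also have "\<dots> = event_prob r J A"
    unfolding mC event_prob_def using J(1) by (intro sum.mono_neutral_cong_left) (simp_all, blast)
  finally show "measure ?M ?C = event_prob r J A" .
qed

section \<open>Open paths, level by level\<close>

text \<open>
  For a set \<open>W\<close> of open edges, \<open>level_step E W n\<close> relates \<open>a\<close> to \<open>b\<close> if the edge from \<open>(a, n)\<close> to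
  \<open>(b, n + 1)\<close> is open, and \<open>level_conn E W n l\<close> relates \<open>a\<close> to \<open>b\<close> if an open path leads from
  \<open>(a, n)\<close> to \<open>(b, n + l)\<close>. Since every edge climbs one level, the vertices of such a path are
  automatically distinct. The level of an edge \<open>e\<close> is \<open>snd (fst e)\<close>, that of its lower endpoint.
\<close>

definition level_step :: "'a set set \<Rightarrow> 'a ladder_edge set \<Rightarrow> int \<Rightarrow> ('a \<times> 'a) set" where
  "level_step E W n = {(a, b). {a, b} \<in> E \<and> ((a, n), (b, n + 1)) \<in> W}"

primrec level_conn :: "'a set set \<Rightarrow> 'a ladder_edge set \<Rightarrow> int \<Rightarrow> nat \<Rightarrow> ('a \<times> 'a) set" where
  "level_conn E W n 0 = Id"
| "level_conn E W n (Suc l) = level_conn E W n l O level_step E W (n + int l)"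

text \<open>
  Some vertex at height \<open>n + l\<close> can be reached from \<open>(x, n)\<close>.
\<close>

definition reaches :: "'a set set \<Rightarrow> 'a \<Rightarrow> int \<Rightarrow> nat \<Rightarrow> 'a ladder_edge set \<Rightarrow> bool" where
  "reaches E x n l W \<longleftrightarrow> (\<exists>y. (x, y) \<in> level_conn E W n l)"

text \<open>
  The neighbourhood relation of a graph; \<open>adjacency E ^^ l\<close> relates the ends of walks of length \<open>l\<close>.
\<close>

definition adjacency :: "'a set set \<Rightarrow> ('a \<times> 'a) set" where
  "adjacency E = {(a, b). {a, b} \<in> E}"

lemma level_conn_add:
  "level_conn E W n (l + m) = level_conn E W n l O level_conn E W (n + int l) m"
  by (induction m) (auto simp: O_assoc add.assoc)

lemma level_conn_cong:
  assumes "\<And>e. n \<le> snd (fst e) \<Longrightarrow> snd (fst e) < n + int l \<Longrightarrow> e \<in> W \<longleftrightarrow> e \<in> W'"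
  shows "level_conn E W n l = level_conn E W' n l"
  using assms
proof (induction l)
  case (Suc l)
  have "level_step E W (n + int l) = level_step E W' (n + int l)"
    unfolding level_step_def using Suc.prems[of "((_, n + int l), _)"] by auto
  moreover have "level_conn E W n l = level_conn E W' n l"
    by (rule Suc.IH) (use Suc.prems in auto)
  ultimately show ?case by simp
qed simp

lemma level_conn_mono:
  assumes "W \<subseteq> W'"
  shows "level_conn E W n l \<subseteq> level_conn E W' n l"
proof (induction l)
  case (Suc l)
  then show ?case using assms by (auto simp: level_step_def relcomp_unfold)
qed simp

lemma mono_reaches: "mono (reaches E x n l)"
proof (intro monoI le_boolI)
  fix W W' assume "W \<subseteq> W'" "reaches E x n l W"
  then show "reaches E x n l W'" unfolding reaches_def using level_conn_mono[of W W' E n l] by auto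
qed

lemma reaches_antimono: "reaches E x n (l + m) W \<Longrightarrow> reaches E x n l W"
  unfolding reaches_def level_conn_add by auto

lemma level_conn_subset_adjacency: "level_conn E W n l \<subseteq> adjacency E ^^ l"
proof (induction l)
  case (Suc l)
  then show ?case by (auto simp: level_step_def adjacency_def)
qed simp

text \<open>Replacing a configuration on a window of levels by one that connects more pairs there.\<close>

lemma reaches_transfer:
  assumes "reaches E x n (k + T + m) W"
    and agree: "\<And>e. \<not> (n + int k \<le> snd (fst e) \<and> snd (fst e) < n + int k + int T) \<Longrightarrow> e \<in> W \<longleftrightarrow> e \<in> W'"
    and sub: "level_conn E W (n + int k) T \<subseteq> level_conn E W' (n + int k) T"
  shows "reaches E x n (k + T + m) W'"
proof -
  have "level_conn E W n k = level_conn E W' n k"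
    by (rule level_conn_cong) (rule agree, simp)
  moreover have "level_conn E W (n + int k + int T) m = level_conn E W' (n + int k + int T) m"
    by (rule level_conn_cong) (rule agree, simp)
  ultimately have "level_conn E W n (k + T + m) \<subseteq> level_conn E W' n (k + T + m)"
    unfolding level_conn_add of_nat_add add.assoc[symmetric] using sub by (intro relcomp_mono) simp_all
  with assms(1) show ?thesis unfolding reaches_def by auto
qed

lemma open_path_imp_level_conn:
  assumes "open_path V E \<omega> xs" "hd xs = (a, n)"
  shows "\<exists>l b. last xs = (b, n + int l) \<and> (a, b) \<in> level_conn E {e \<in> ladder_edges E. \<omega> e} n l"
  using assms
proof (induction xs rule: rev_induct)
  case Nil
  then show ?case by (simp add: open_path_def)
next
  case (snoc x xs)
  show ?case
  proof (cases "xs = []")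
    case True
    then show ?thesis using snoc.prems by (auto intro!: exI[of _ 0])
  next
    case False
    have "open_path V E \<omega> xs" "hd xs = (a, n)"
      using snoc.prems False by (auto simp: open_path_def successively_append_iff)
    from snoc.IH[OF this] obtain l b where l: "last xs = (b, n + int l)"
      "(a, b) \<in> level_conn E {e \<in> ladder_edges E. \<omega> e} n l" by blast
    have "(last xs, x) \<in> ladder_edges E" "\<omega> (last xs, x)"
      using snoc.prems False by (auto simp: open_path_def successively_append_iff)
    then obtain c where c: "x = (c, n + int (Suc l))" "(b, c) \<in> level_step E {e \<in> ladder_edges E. \<omega> e} (n + int l)"
      unfolding l(1) by (auto simp: ladder_edges_def level_step_def)
    with l(2) show ?thesis by (auto intro!: exI[of _ "Suc l"])
  qed
qed

lemma level_conn_imp_open_path: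
  assumes E: "\<Union>E \<subseteq> V" and "a \<in> V"
    and "(a, b) \<in> level_conn E {e \<in> ladder_edges E. \<omega> e} n l"
  shows "\<exists>xs. open_path V E \<omega> xs \<and> hd xs = (a, n) \<and> last xs = (b, n + int l) \<and>
    (\<forall>y\<in>set xs. snd y \<le> n + int l)"
  using assms(3)
proof (induction l arbitrary: b)
  case 0
  then show ?case using \<open>a \<in> V\<close>
    by (intro exI[of _ "[(a, n)]"]) (auto simp: open_path_def ladder_vertices_def)
next
  case (Suc l)
  then obtain c where c: "(a, c) \<in> level_conn E {e \<in> ladder_edges E. \<omega> e} n l"
    "(c, b) \<in> level_step E {e \<in> ladder_edges E. \<omega> e} (n + int l)" by auto
  from Suc.IH[OF c(1)] obtain xs where xs: "open_path V E \<omega> xs" "hd xs = (a, n)"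
    "last xs = (c, n + int l)" "\<forall>y\<in>set xs. snd y \<le> n + int l" by blast
  have b: "b \<in> V" "((c, n + int l), (b, n + int (Suc l))) \<in> ladder_edges E"
    "\<omega> ((c, n + int l), (b, n + int (Suc l)))"
    using c(2) E by (fastforce simp: level_step_def add_ac)+
  have "(b, n + int (Suc l)) \<notin> set xs" using xs(4) by force
  then have "open_path V E \<omega> (xs @ [(b, n + int (Suc l))])"
    using xs(1,3) b by (auto simp: open_path_def successively_append_iff ladder_vertices_def)
  then show ?case using xs
    by (intro exI[of _ "xs @ [(b, n + int (Suc l))]"]) (auto simp: open_path_def)
qed

lemma forward_cluster_eq:
  assumes "\<Union>E \<subseteq> V" and "a \<in> V"
  shows "forward_cluster V E \<omega> (a, n) =
    (\<Union>l. (\<lambda>b. (b, n + int l)) ` (level_conn E {e \<in> ladder_edges E. \<omega> e} n l `` {a}))" (is "_ = ?R")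
proof (intro set_eqI iffI)
  fix y assume "y \<in> forward_cluster V E \<omega> (a, n)"
  then consider "y = (a, n)" | xs where "open_path V E \<omega> xs" "hd xs = (a, n)" "last xs = y"
    by (auto simp: forward_cluster_def)
  then show "y \<in> ?R"
  proof cases
    case 1
    then show ?thesis by (auto intro!: exI[of _ 0])
  next
    case 2
    from open_path_imp_level_conn[OF 2(1,2)] 2(3) show ?thesis by blast
  qed
next
  fix y assume "y \<in> ?R"
  then obtain l b where "y = (b, n + int l)" "(a, b) \<in> level_conn E {e \<in> ladder_edges E. \<omega> e} n l" by auto
  with level_conn_imp_open_path[OF assms this(2)] show "y \<in> forward_cluster V E \<omega> (a, n)"
    unfolding forward_cluster_def by blast
qed

text \<open>
  If only finitely many vertices are reachable at each level, a cluster is infinite precisely when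
  it reaches every level.
\<close>

lemma infinite_forward_cluster_iff:
  assumes "\<Union>E \<subseteq> V" and "a \<in> V" and fin: "\<And>l. finite (level_conn E {e \<in> ladder_edges E. \<omega> e} n l `` {a})"
  shows "infinite (forward_cluster V E \<omega> (a, n)) \<longleftrightarrow> (\<forall>l. reaches E a n l {e \<in> ladder_edges E. \<omega> e})"
    (is "_ \<longleftrightarrow> (\<forall>l. reaches E a n l ?W)")
proof
  assume inf: "infinite (forward_cluster V E \<omega> (a, n))"
  show "\<forall>l. reaches E a n l ?W"
  proof (rule ccontr)
    assume "\<not> (\<forall>l. reaches E a n l ?W)"
    then obtain k where k: "\<not> reaches E a n k ?W" by blast
    have empty: "level_conn E ?W n l `` {a} = {}" if "l \<ge> k" for l
      using k reaches_antimono[of E a n k "l - k" ?W] that by (auto simp: reaches_def)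
    have "forward_cluster V E \<omega> (a, n) \<subseteq> (\<Union>l<k. (\<lambda>b. (b, n + int l)) ` (level_conn E ?W n l `` {a}))"
    proof
      fix y assume "y \<in> forward_cluster V E \<omega> (a, n)"
      then obtain l where l: "y \<in> (\<lambda>b. (b, n + int l)) ` (level_conn E ?W n l `` {a})"
        using forward_cluster_eq[OF assms(1,2), where \<omega> = \<omega> and n = n] by blast
      with empty[of l] have "l < k" by (cases "l < k") simp_all
      with l show "y \<in> (\<Union>l<k. (\<lambda>b. (b, n + int l)) ` (level_conn E ?W n l `` {a}))" by blast
    qed
    moreover have "finite (\<Union>l<k. (\<lambda>b. (b, n + int l)) ` (level_conn E ?W n l `` {a}))"
      using fin by simp
    ultimately show False using inf finite_subset by blast
  qed
next
  assume "\<forall>l. reaches E a n l ?W"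
  then have "\<forall>l. \<exists>b. (b, n + int l) \<in> forward_cluster V E \<omega> (a, n)"
    unfolding forward_cluster_eq[OF assms(1,2)] reaches_def by blast
  then have "range (\<lambda>l. n + int l) \<subseteq> snd ` forward_cluster V E \<omega> (a, n)"
    by (metis image_eqI image_subsetI snd_conv)
  moreover have "infinite (range (\<lambda>l. n + int l))"
    by (intro range_inj_infinite injI) auto
  ultimately show "infinite (forward_cluster V E \<omega> (a, n))"
    using finite_subset by blast
qed

lemma finite_adjacency_relpow:
  assumes "\<And>a. finite {b. {a, b} \<in> E}"
  shows "finite ((adjacency E ^^ l) `` {a})"
proof (induction l)
  case (Suc l)
  have "(adjacency E ^^ Suc l) `` {a} = (\<Union>c\<in>(adjacency E ^^ l) `` {a}. {b. {c, b} \<in> E})"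
    by (auto simp: adjacency_def)
  then show ?case using Suc assms by simp
qed simp

section \<open>Rerouting around a closed level of the distinguished columns\<close>

lemma sym_relpow:
  assumes "sym R" "(x, y) \<in> R ^^ l"
  shows "(y, x) \<in> R ^^ l"
  using assms(2)
proof (induction l arbitrary: y)
  case (Suc l)
  then obtain z where "(x, z) \<in> R ^^ l" "(z, y) \<in> R" by auto
  with Suc.IH[of z] assms(1) show ?case by (intro relpow_Suc_I2[where y = z]) (auto dest: symD)
qed simp

lemma sym_adjacency: "sym (adjacency D)"
  by (auto simp: sym_def adjacency_def insert_commute)

lemma adjacency_relpow_Union:
  assumes "(x, y) \<in> adjacency D ^^ l" "x \<in> \<Union>D"
  shows "y \<in> \<Union>D"
  using assms by (cases l) (auto simp: adjacency_def)

text \<open>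
  In a finite graph without isolated vertices, a pair of vertices joined by some walk is joined by
  walks of every sufficiently large length of the same parity: extend a shortest walk of that parity by going back
  and forth along an edge.
\<close>

lemma walk_parity:
  assumes "finite D" and D: "\<And>e. e \<in> D \<Longrightarrow> \<exists>a b. e = {a, b}"
  shows "\<exists>L. \<forall>x\<in>\<Union>D. \<forall>y l l'. (x, y) \<in> adjacency D ^^ l \<longrightarrow> L \<le> l' \<longrightarrow> even (l + l') \<longrightarrow>
    (x, y) \<in> adjacency D ^^ l'"
proof -
  let ?R = "adjacency D"
  have loop2: "(x, x) \<in> ?R ^^ 2" if "x \<in> \<Union>D" for x
  proof -
    from that obtain e where "e \<in> D" "x \<in> e" by blast
    with D obtain z where "{x, z} \<in> D" by (metis insertE insert_commute singletonD)
    then have "(x, z) \<in> ?R" "(z, x) \<in> ?R" by (auto simp: adjacency_def insert_commute)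
    then show ?thesis by (auto simp: numeral_2_eq_2)
  qed
  have loop: "(x, x) \<in> ?R ^^ (2 * j)" if "x \<in> \<Union>D" for x j
  proof (induction j)
    case (Suc j)
    then have "(x, x) \<in> ?R ^^ (2 * j + 2)"
      unfolding relpow_add by (rule relcompI) (rule loop2[OF that])
    then show ?case by simp
  qed simp
  \<comment> \<open>The length of a shortest walk from \<open>x\<close> to \<open>y\<close> of even (\<open>b\<close>) or odd (\<open>\<not> b\<close>) length.\<close>
  define f where "f = (\<lambda>(x, y, b). LEAST l. (x, y) \<in> ?R ^^ l \<and> even l = b)"
  have "finite e" if "e \<in> D" for e using D[OF that] by auto
  then have "finite (\<Union>D)" using assms(1) by blast
  then have "finite (f ` (\<Union>D \<times> \<Union>D \<times> UNIV))" by auto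
  then obtain L where L: "\<And>t. t \<in> \<Union>D \<times> \<Union>D \<times> UNIV \<Longrightarrow> f t \<le> L"
    unfolding finite_nat_set_iff_bounded_le by blast
  have "(x, y) \<in> ?R ^^ l'" if x: "x \<in> \<Union>D" and l: "(x, y) \<in> ?R ^^ l" and l': "L \<le> l'" "even (l + l')" for x y l l'
  proof -
    define k where "k = f (x, y, even l)"
    have k: "(x, y) \<in> ?R ^^ k \<and> even k = even l"
      unfolding k_def f_def prod.case by (rule LeastI[of _ l]) (simp add: l)
    have "k \<le> l'" using L[of "(x, y, even l)"] x adjacency_relpow_Union[OF l x] l'(1) by (simp add: k_def)
    moreover have "even (l' - k)" using k l'(2) \<open>k \<le> l'\<close> by auto
    ultimately obtain j where "l' = 2 * j + k" by (metis dvdE le_add_diff_inverse2)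
    then show ?thesis unfolding \<open>l' = 2 * j + k\<close> relpow_add using loop[OF x, of j] k by (intro relcompI) auto
  qed
  then show ?thesis by blast
qed

text \<open>
  From every vertex of a finite set \<open>D\<close> of edges, a walk in \<open>D\<close> leads to a vertex that has an
  edge outside \<open>D\<close>; otherwise the component of \<open>D\<close> would be all of the infinite graph.
\<close>

lemma finite_set_escape:
  assumes "connected_graph V E" "infinite V" "finite D" "D \<subseteq> E" "x \<in> \<Union>D"
  shows "\<exists>d w z. (x, w) \<in> adjacency D ^^ d \<and> {w, z} \<in> E - D"
proof (rule ccontr)
  assume no: "\<not> ?thesis"
  have E: "\<And>e. e \<in> E \<Longrightarrow> \<exists>u\<in>V. \<exists>v\<in>V. u \<noteq> v \<and> e = {u, v}"
    and conn: "\<And>u v. u \<in> V \<Longrightarrow> v \<in> V \<Longrightarrow> (u, v) \<in> {(x, y). {x, y} \<in> E}\<^sup>*"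
    using assms(1) unfolding connected_graph_def by blast+
  have "x \<in> V" using assms(4,5) E by blast
  have "(x, y) \<in> (adjacency D)\<^sup>*" if "y \<in> V" for y
    using conn[OF \<open>x \<in> V\<close> that]
  proof (induction rule: rtrancl_induct)
    case (step y z)
    from step.IH obtain d where "(x, y) \<in> adjacency D ^^ d" using rtrancl_imp_relpow by metis
    with no step.hyps have "(y, z) \<in> adjacency D" unfolding adjacency_def by blast
    with step.IH show ?case by simp
  qed simp
  then have "V \<subseteq> \<Union>D" using adjacency_relpow_Union[OF _ assms(5)] by (metis rtrancl_imp_relpow subsetI)
  moreover have "finite M" if "M \<in> D" for M using E[of M] assms(4) that by auto
  then have "finite (\<Union>D)" using assms(3) by blast
  ultimately show False using assms(2) finite_subset by blast
qed

text \<open>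
  The edges of the ladder graph, at the \<open>T\<close> levels from \<open>n\<close> on, that project to an edge of \<open>E\<close>
  with an endpoint in \<open>U\<close>.
\<close>

definition block :: "'a set set \<Rightarrow> 'a set \<Rightarrow> int \<Rightarrow> nat \<Rightarrow> 'a ladder_edge set" where
  "block E U n T = {((a, s), (b, s + 1)) | a b s. {a, b} \<in> E \<and> (a \<in> U \<or> b \<in> U) \<and> n \<le> s \<and> s < n + int T}"

lemma block_iff:
  "((a, s), (b, s + 1)) \<in> block E U n T \<longleftrightarrow> {a, b} \<in> E \<and> (a \<in> U \<or> b \<in> U) \<and> n \<le> s \<and> s < n + int T"
  by (simp add: block_def)

lemma ladder_edges_iff: "((a, s), (b, s + 1)) \<in> ladder_edges E \<longleftrightarrow> {a, b} \<in> E"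
  by (simp add: ladder_edges_def)

lemma finite_block:
  assumes lf: "\<And>a. finite {b. {a, b} \<in> E}" and "finite U"
  shows "finite (block E U n T)"
proof (rule finite_subset)
  let ?P = "(SIGMA a:U. {b. {a, b} \<in> E})"
  show "block E U n T \<subseteq> (\<lambda>((a, b), s). ((a, s), (b, s + 1))) ` ((?P \<union> prod.swap ` ?P) \<times> {n..<n + int T})"
  proof
    fix e assume "e \<in> block E U n T"
    then obtain a b s where e: "e = ((a, s), (b, s + 1))" "{a, b} \<in> E" "a \<in> U \<or> b \<in> U" "n \<le> s" "s < n + int T"
      unfolding block_def by blast
    have "(a, b) \<in> ?P \<union> prod.swap ` ?P" using e(2,3) by (auto simp: insert_commute image_iff)
    with e show "e \<in> (\<lambda>((a, b), s). ((a, s), (b, s + 1))) ` ((?P \<union> prod.swap ` ?P) \<times> {n..<n + int T})"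
      by (intro image_eqI[of _ _ "((a, b), s)"]) auto
  qed
qed (use assms in auto)

text \<open>
  A walk in \<open>D\<close> that crosses a block can be replaced by one that does not use the columns of \<open>D\<close> at
  level \<open>n + L + 1\<close>: walk in \<open>D\<close> to a vertex \<open>w\<close> with an edge \<open>{w, z}\<close> outside \<open>D\<close>, cross the
  critical level along this edge, return to \<open>w\<close> and walk in \<open>D\<close> to the original endpoint. The
  detour takes two steps, so the parity is right, and \<open>L\<close> levels on either side are enough for the two
  walks in \<open>D\<close>.
\<close>

lemma rerouting:
  assumes D: "D \<subseteq> E" and L: "\<forall>x\<in>\<Union>D. \<forall>y l l'. (x, y) \<in> adjacency D ^^ l \<longrightarrow> L \<le> l' \<longrightarrow> even (l + l') \<longrightarrow>
      (x, y) \<in> adjacency D ^^ l'"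
    and esc: "\<forall>x\<in>\<Union>D. \<exists>d w z. (x, w) \<in> adjacency D ^^ d \<and> {w, z} \<in> E - D"
    and x: "x \<in> \<Union>D" and xy: "(x, y) \<in> adjacency D ^^ (2 * L + 3)"
    and W: "\<And>e. e \<in> block E (\<Union>D) n (2 * L + 3) \<Longrightarrow> e \<in> ladder_edges D \<Longrightarrow> snd (fst e) \<noteq> n + int (L + 1) \<Longrightarrow> e \<in> W"
      "\<And>e. e \<in> block E (\<Union>D) n (2 * L + 3) \<Longrightarrow> e \<notin> ladder_edges D \<Longrightarrow> e \<in> W"
  shows "(x, y) \<in> level_conn E W n (2 * L + 3)"
proof -
  have walk: "(a, b) \<in> level_conn E W m l"
    if "(a, b) \<in> adjacency D ^^ l" "a \<in> \<Union>D" "n \<le> m" "m + int l \<le> n + int (2 * L + 3)"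
      "m + int l \<le> n + int (L + 1) \<or> n + int (L + 1) < m" for a b m l
    using that
  proof (induction l arbitrary: b)
    case (Suc l)
    then obtain c where c: "(a, c) \<in> adjacency D ^^ l" "{c, b} \<in> D" by (auto simp: adjacency_def)
    have "c \<in> \<Union>D" using c by auto
    have "((c, m + int l), (b, m + int l + 1)) \<in> W"
      using c \<open>c \<in> \<Union>D\<close> D Suc.prems by (intro W(1)) (auto simp: block_iff ladder_edges_iff)
    then have "(c, b) \<in> level_step E W (m + int l)" using c D by (auto simp: level_step_def)
    moreover have "(a, c) \<in> level_conn E W m l" by (rule Suc.IH) (use c Suc.prems in auto)
    ultimately show ?case by auto
  qed simp
  have detour: "(w, z) \<in> level_step E W m" "(z, w) \<in> level_step E W m"
    if "{w, z} \<in> E - D" "w \<in> \<Union>D" "n \<le> m" "m < n + int (2 * L + 3)" for w z m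
  proof -
    have "((w, m), (z, m + 1)) \<in> W" "((z, m), (w, m + 1)) \<in> W"
      by (rule W(2); use that in \<open>simp add: block_iff ladder_edges_iff insert_commute[of z w] del: Union_iff\<close>)+
    then show "(w, z) \<in> level_step E W m" "(z, w) \<in> level_step E W m"
      using that by (simp_all add: level_step_def insert_commute[of z w])
  qed
  from esc x obtain d w z where w: "(x, w) \<in> adjacency D ^^ d" "{w, z} \<in> E - D" by blast
  have wU: "w \<in> \<Union>D" using adjacency_relpow_Union[OF w(1) x] .
  \<comment> \<open>The detour occupies the levels \<open>s\<close> and \<open>s + 1\<close>, one of which is \<open>L + 1\<close>; parity decides which.\<close>
  have "\<exists>s\<in>{L, L + 1}. even (d + s)" by auto
  then obtain s where s: "s = L \<or> s = L + 1" "even (d + s)" by blast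
  define s' where "s' = 2 * L + 3 - s - 2"
  have s': "2 * L + 3 = s + (1 + (1 + s'))" "L \<le> s'" "s' \<le> L + 1" using s(1) by (auto simp: s'_def)
  have "(x, w) \<in> adjacency D ^^ s" by (rule L[rule_format, OF x w(1)]) (use s in auto)
  then have 1: "(x, w) \<in> level_conn E W n s" by (rule walk[OF _ x]) (use s in auto)
  have "(w, y) \<in> adjacency D ^^ (d + (2 * L + 3))"
    unfolding relpow_add[of d] by (rule relcompI[OF sym_relpow[OF sym_adjacency w(1)] xy])
  then have "(w, y) \<in> adjacency D ^^ s'"
    by (rule L[rule_format, OF wU]) (use s(2) s' in \<open>auto simp: s'(1)\<close>)
  then have 4: "(w, y) \<in> level_conn E W (n + int s + 1 + 1) s'"
    by (rule walk[OF _ wU]) (use s s' in auto)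
  have 2: "(w, z) \<in> level_conn E W (n + int s) 1" "(z, w) \<in> level_conn E W (n + int s + 1) 1"
    using detour[OF w(2) wU] s by auto
  show ?thesis
    unfolding s'(1) level_conn_add of_nat_1 using 1 2 4 by blast
qed

text \<open>
  Fix the configuration \<open>S'\<close> outside a block. As a function of the configuration \<open>S\<close> inside the block,
  the event that the vertex \<open>(x, n0)\<close> reaches a level above the block is constant, or some edge of the
  block outside the distinguished columns is pivotal for it.

  Suppose that no such edge is pivotal, so that the event \<open>A\<close> ignores them, and that \<open>A\<close> holds for
  the full block. Then it holds if exactly the distinguished columns are open (the set \<open>Q\<close> below).
  By rerouting it still holds when they are closed at one level and the other edges of the block are
  open, hence also when those other edges are closed (the set \<open>Qt\<close>). In this last configuration no open path crosses the
  block through the vertices of \<open>D\<close>, so the empty configuration is just as good.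
\<close>

lemma block_dichotomy:
  fixes x :: 'a and n0 :: int and k m :: nat
  assumes D: "D \<subseteq> E" "\<And>e. e \<in> D \<Longrightarrow> \<exists>a b. e = {a, b}" and fin: "finite (block E (\<Union>D) n (2 * L + 3))"
    and L: "\<forall>x\<in>\<Union>D. \<forall>y l l'. (x, y) \<in> adjacency D ^^ l \<longrightarrow> L \<le> l' \<longrightarrow> even (l + l') \<longrightarrow>
      (x, y) \<in> adjacency D ^^ l'"
    and esc: "\<forall>x\<in>\<Union>D. \<exists>d w z. (x, w) \<in> adjacency D ^^ d \<and> {w, z} \<in> E - D"
    and S': "S' \<inter> block E (\<Union>D) n (2 * L + 3) = {}" and n: "n = n0 + int k"
  defines "A \<equiv> \<lambda>S. reaches E x n0 (k + (2 * L + 3) + m) (S \<union> S')"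
    and "F \<equiv> block E (\<Union>D) n (2 * L + 3)"
  shows "(\<forall>S\<subseteq>F. A S = A {}) \<or> (\<exists>g\<in>F - ladder_edges D. \<exists>S\<subseteq>F. \<not> A S \<and> A (insert g S))"
proof (rule disjCI)
  assume no_pivot: "\<not> (\<exists>g\<in>F - ladder_edges D. \<exists>S\<subseteq>F. \<not> A S \<and> A (insert g S))"
  let ?U = "\<Union>D" and ?T = "2 * L + 3"
  define Q where "Q = F \<inter> ladder_edges D"
  define Qt where "Qt = {e \<in> Q. snd (fst e) \<noteq> n + int (L + 1)}"
  have monoA: "A S \<Longrightarrow> S \<subseteq> S2 \<Longrightarrow> A S2" for S S2
    unfolding A_def by (rule mono_eventD[OF mono_reaches, of "S \<union> S'"]) auto
  have drop: "A S" if "A (S \<union> P)" "S \<subseteq> F" "P \<subseteq> F - ladder_edges D" for S P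
  proof -
    have "finite P" using that(3) fin finite_subset unfolding F_def by blast
    then show ?thesis using that(1,3)
    proof (induction P rule: finite_induct)
      case (insert g P)
      have "g \<in> F - ladder_edges D" "S \<union> P \<subseteq> F" using insert.prems(2) that(2) by auto
      moreover have "A (insert g (S \<union> P))" using insert.prems(1) by simp
      ultimately have "A (S \<union> P)" using no_pivot by blast
      then show ?case using insert by auto
    qed simp
  qed
  have F_levels: "n \<le> snd (fst e) \<and> snd (fst e) < n + int ?T" if "e \<in> F" for e
    using that by (auto simp: F_def block_def)
  have transfer: "A S2" if "A S1" "S1 \<subseteq> F" "S2 \<subseteq> F"
    "level_conn E (S1 \<union> S') n ?T \<subseteq> level_conn E (S2 \<union> S') n ?T" for S1 S2
    unfolding A_def
  proof (rule reaches_transfer)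
    show "reaches E x n0 (k + ?T + m) (S1 \<union> S')" using that(1) by (simp add: A_def)
    show "level_conn E (S1 \<union> S') (n0 + int k) ?T \<subseteq> level_conn E (S2 \<union> S') (n0 + int k) ?T"
      using that(4) by (simp add: n)
  qed (use F_levels that(2,3) n in blast)
  \<comment> \<open>With all undistinguished edges of the block closed, a path that starts in \<open>?U\<close> stays in the
    columns of \<open>D\<close>, and a path that starts outside \<open>?U\<close> never enters it.\<close>
  have step: "if a \<in> ?U then {a, b} \<in> D \<and> b \<in> ?U \<and> ((a, s), (b, s + 1)) \<in> S
      else b \<notin> ?U \<and> (a, b) \<in> level_step E S' s"
    if ab: "(a, b) \<in> level_step E (S \<union> S') s" and S: "S \<subseteq> Q" and s: "n \<le> s" "s < n + int ?T" for a b s S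
  proof -
    have e: "{a, b} \<in> E" "((a, s), (b, s + 1)) \<in> S \<union> S'" using ab by (auto simp: level_step_def)
    show ?thesis
    proof (cases "a \<in> ?U \<or> b \<in> ?U")
      case True
      then have "((a, s), (b, s + 1)) \<in> F" using e s unfolding F_def block_def by blast
      then have "((a, s), (b, s + 1)) \<in> S" using e S' F_def by blast
      moreover then have "{a, b} \<in> D" using S by (auto simp: Q_def ladder_edges_def)
      ultimately show ?thesis by auto
    next
      case False
      then have "((a, s), (b, s + 1)) \<notin> S" using S by (auto simp: Q_def F_def block_def)
      then show ?thesis using False e by (auto simp: level_step_def)
    qed
  qed
  have walk: "if a \<in> ?U then (a, b) \<in> adjacency D ^^ l \<and> b \<in> ?U
      else b \<notin> ?U \<and> (a, b) \<in> level_conn E S' n l"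
    if "(a, b) \<in> level_conn E (S \<union> S') n l" "S \<subseteq> Q" "l \<le> ?T" for a b l S
    using that
  proof (induction l arbitrary: b)
    case (Suc l)
    then obtain c where c: "(a, c) \<in> level_conn E (S \<union> S') n l" "(c, b) \<in> level_step E (S \<union> S') (n + int l)"
      by auto
    from Suc.IH[OF c(1)] Suc.prems step[OF c(2)] show ?case
      by (auto simp: adjacency_def split: if_splits)
  qed auto
  have "A {}" if "A F"
  proof -
    have "F = Q \<union> (F - ladder_edges D)" by (auto simp: Q_def)
    with that have "A Q" using drop[of Q "F - ladder_edges D"] by (auto simp: Q_def)
    have "A (Qt \<union> (F - ladder_edges D))"
    proof (rule transfer[OF \<open>A Q\<close>])
      show "level_conn E (Q \<union> S') n ?T \<subseteq> level_conn E (Qt \<union> (F - ladder_edges D) \<union> S') n ?T"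
      proof (rule subrelI)
        fix a b assume ab: "(a, b) \<in> level_conn E (Q \<union> S') n ?T"
        show "(a, b) \<in> level_conn E (Qt \<union> (F - ladder_edges D) \<union> S') n ?T"
        proof (cases "a \<in> ?U")
          case True
          with walk[OF ab] have "(a, b) \<in> adjacency D ^^ ?T" by auto
          from D(1) L esc True this show ?thesis
            by (rule rerouting) (auto simp: Qt_def Q_def F_def)
        next
          case False
          with walk[OF ab] have "(a, b) \<in> level_conn E S' n ?T" by auto
          then show ?thesis using level_conn_mono[of S' "Qt \<union> (F - ladder_edges D) \<union> S'"] by blast
        qed
      qed
    qed (auto simp: Qt_def Q_def)
    then have "A Qt" by (rule drop) (auto simp: Qt_def Q_def)
    then show "A {}"
    proof (rule transfer)
      show "level_conn E (Qt \<union> S') n ?T \<subseteq> level_conn E ({} \<union> S') n ?T"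
      proof (rule subrelI)
        fix a b assume ab: "(a, b) \<in> level_conn E (Qt \<union> S') n ?T"
        have QtQ: "Qt \<subseteq> Q" by (auto simp: Qt_def)
        have "a \<notin> ?U"
        proof
          assume a: "a \<in> ?U"
          have T: "?T = Suc (L + 1) + (L + 1)" by simp
          have "level_conn E (Qt \<union> S') n ?T =
            (level_conn E (Qt \<union> S') n (L + 1) O level_step E (Qt \<union> S') (n + int (L + 1)))
              O level_conn E (Qt \<union> S') (n + int (Suc (L + 1))) (L + 1)"
            unfolding T level_conn_add[of E _ n "Suc (L + 1)"] level_conn.simps(2)[of E _ n "L + 1"] ..
          with ab have "(a, b) \<in> (level_conn E (Qt \<union> S') n (L + 1) O
              level_step E (Qt \<union> S') (n + int (L + 1))) O level_conn E (Qt \<union> S') (n + int (Suc (L + 1))) (L + 1)"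
            by (simp only:)
          then obtain c d where c: "(a, c) \<in> level_conn E (Qt \<union> S') n (L + 1)"
            "(c, d) \<in> level_step E (Qt \<union> S') (n + int (L + 1))"
            by (elim relcompEpair)
          from walk[OF c(1) QtQ] a have "c \<in> ?U" by auto
          with step[OF c(2) QtQ] have "((c, n + int (L + 1)), (d, n + int (L + 1) + 1)) \<in> Qt" by auto
          then show False by (simp add: Qt_def)
        qed
        with walk[OF ab QtQ] show "(a, b) \<in> level_conn E ({} \<union> S') n ?T" by auto
      qed
    qed (auto simp: Qt_def Q_def)
  qed
  then show "\<forall>S\<subseteq>F. A S = A {}" using monoA by blast
qed

section \<open>Comparison of product laws\<close>

text \<open>
  Let \<open>A\<close> be an increasing event on the finite edge set \<open>F\<close> that is constant or has a pivotal edge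
  outside \<open>Q\<close>. Raising the probabilities outside \<open>Q\<close> from \<open>r\<close> to \<open>r'\<close> strictly increases the
  probability of a nonconstant \<open>A\<close>, so by continuity it outweighs a change by at most \<open>d\<close> of the
  probabilities in \<open>Q\<close>. As there are only finitely many events on \<open>F\<close>, one \<open>d\<close> serves all of them.
\<close>

lemma block_domination:
  fixes r r' :: "'e \<Rightarrow> real"
  assumes fin: "finite F" and r: "\<And>e. e \<in> F \<Longrightarrow> 0 < r e \<and> r e < 1"
    and r': "\<And>e. e \<in> F - Q \<Longrightarrow> r e < r' e \<and> r' e \<le> 1"
  shows "\<exists>d>0. \<forall>A s s'. mono A \<longrightarrow>
    (\<forall>S\<subseteq>F. A S = A {}) \<or> (\<exists>g\<in>F - Q. \<exists>S\<subseteq>F. \<not> A S \<and> A (insert g S)) \<longrightarrow>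
    (\<forall>e\<in>F. 0 \<le> s e \<and> s e \<le> (if e \<in> Q then r e + d else r e)) \<longrightarrow>
    (\<forall>e\<in>F. (if e \<in> Q then r e - d else r' e) \<le> s' e \<and> s' e \<le> 1) \<longrightarrow>
    event_prob s F A \<le> event_prob s' F A"
proof -
  define up where "up d e = (if e \<in> Q then r e + d else r e)" for d e
  define lo where "lo d e = (if e \<in> Q then r e - d else r' e)" for d e
  have lim: "((\<lambda>d. up d e) \<longlongrightarrow> up 0 e) (at_right 0)" "((\<lambda>d. lo d e) \<longlongrightarrow> lo 0 e) (at_right 0)" for e
    unfolding up_def lo_def by (cases "e \<in> Q"; auto intro!: tendsto_eq_intros)+
  have less: "\<forall>\<^sub>F d in at_right 0. event_prob (up 0) F (\<lambda>S. S \<in> \<A>) < event_prob (lo 0) F (\<lambda>S. S \<in> \<A>) \<longrightarrow>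
      event_prob (up d) F (\<lambda>S. S \<in> \<A>) < event_prob (lo d) F (\<lambda>S. S \<in> \<A>)" for \<A> :: "'e set set"
  proof (cases "event_prob (up 0) F (\<lambda>S. S \<in> \<A>) < event_prob (lo 0) F (\<lambda>S. S \<in> \<A>)")
    case True
    have "((\<lambda>d. event_prob (lo d) F (\<lambda>S. S \<in> \<A>) - event_prob (up d) F (\<lambda>S. S \<in> \<A>)) \<longlongrightarrow>
        event_prob (lo 0) F (\<lambda>S. S \<in> \<A>) - event_prob (up 0) F (\<lambda>S. S \<in> \<A>)) (at_right 0)"
      by (intro tendsto_diff continuous_event_prob lim)
    from order_tendstoD(1)[OF this, of 0] True show ?thesis
      by (simp add: eventually_mono)
  qed simp
  have "\<forall>\<^sub>F d in at_right 0. 0 < d \<and> (\<forall>\<A>\<in>Pow (Pow F).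
      event_prob (up 0) F (\<lambda>S. S \<in> \<A>) < event_prob (lo 0) F (\<lambda>S. S \<in> \<A>) \<longrightarrow>
      event_prob (up d) F (\<lambda>S. S \<in> \<A>) < event_prob (lo d) F (\<lambda>S. S \<in> \<A>)) \<and>
      (\<forall>e\<in>F. r e + d < 1 \<and> 0 < r e - d)"
  proof (intro eventually_conj eventually_ball_finite ballI)
    show "\<forall>\<^sub>F d::real in at_right 0. 0 < d" by (rule eventually_at_right_less)
    fix e assume e: "e \<in> F"
    have "((\<lambda>d. r e + d) \<longlongrightarrow> r e) (at_right 0)" "((\<lambda>d. r e - d) \<longlongrightarrow> r e) (at_right 0)"
      by (auto intro!: tendsto_eq_intros)
    then show "\<forall>\<^sub>F d in at_right 0. r e + d < 1" "\<forall>\<^sub>F d in at_right 0. 0 < r e - d"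
      using r[OF e] by (auto dest: order_tendstoD)
  next
    show "finite (Pow (Pow F))" "finite F" using fin by simp_all
  qed (rule less)
  then have "\<exists>d. 0 < d \<and> (\<forall>\<A>\<in>Pow (Pow F).
      event_prob (up 0) F (\<lambda>S. S \<in> \<A>) < event_prob (lo 0) F (\<lambda>S. S \<in> \<A>) \<longrightarrow>
      event_prob (up d) F (\<lambda>S. S \<in> \<A>) < event_prob (lo d) F (\<lambda>S. S \<in> \<A>)) \<and>
      (\<forall>e\<in>F. r e + d < 1 \<and> 0 < r e - d)"
    by (rule eventually_happens'[OF trivial_limit_at_right_real])
  then obtain d where d: "0 < d"
    "\<forall>\<A>\<in>Pow (Pow F).
      event_prob (up 0) F (\<lambda>S. S \<in> \<A>) < event_prob (lo 0) F (\<lambda>S. S \<in> \<A>) \<longrightarrow>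
      event_prob (up d) F (\<lambda>S. S \<in> \<A>) < event_prob (lo d) F (\<lambda>S. S \<in> \<A>)"
    "\<forall>e\<in>F. r e + d < 1 \<and> 0 < r e - d"
    by (elim exE conjE)
  have main: "event_prob s F A \<le> event_prob s' F A"
    if A: "mono A" and dich: "(\<forall>S\<subseteq>F. A S = A {}) \<or> (\<exists>g\<in>F - Q. \<exists>S\<subseteq>F. \<not> A S \<and> A (insert g S))"
      and s: "\<forall>e\<in>F. 0 \<le> s e \<and> s e \<le> (if e \<in> Q then r e + d else r e)"
      and s': "\<forall>e\<in>F. (if e \<in> Q then r e - d else r' e) \<le> s' e \<and> s' e \<le> 1" for A s s'
    using dich
  proof
    assume const: "\<forall>S\<subseteq>F. A S = A {}"
    have "event_prob t F A = event_prob t F (\<lambda>_. A {})" for t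
    proof (rule event_prob_cong[OF refl])
      fix S assume "S \<subseteq> F"
      with const show "A S = A {}" by blast
    qed
    then have "event_prob t F A = of_bool (A {})" for t
      by (simp only: event_prob_const[OF fin])
    then show ?thesis by (simp only: order_refl)
  next
    assume "\<exists>g\<in>F - Q. \<exists>S\<subseteq>F. \<not> A S \<and> A (insert g S)"
    then obtain g S where g: "g \<in> F" "g \<notin> Q" "S \<subseteq> F" "\<not> A S" "A (insert g S)" by blast
    have cong: "event_prob t F (\<lambda>S. S \<in> {S \<in> Pow F. A S}) = event_prob t F A" for t
      by (rule event_prob_cong) auto
    have "event_prob (up 0) F A < event_prob (lo 0) F A"
      using fin _ A g(1) _ g(3-5)
    proof (rule event_prob_strict_mono)
      show "0 < up 0 e \<and> up 0 e < 1 \<and> up 0 e \<le> lo 0 e \<and> lo 0 e \<le> 1" if "e \<in> F" for e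
        using r[OF that] r'[of e] that by (auto simp: up_def lo_def)
      show "up 0 g < lo 0 g" using r'[of g] g by (auto simp: up_def lo_def)
    qed
    moreover have "{S \<in> Pow F. A S} \<in> Pow (Pow F)" by auto
    ultimately have less: "event_prob (up d) F A < event_prob (lo d) F A"
      using d(2)[rule_format, of "{S \<in> Pow F. A S}", unfolded cong] by (simp only:)
    have "event_prob s F A \<le> event_prob (up d) F A"
      using fin _ A
    proof (rule event_prob_mono)
      fix e assume e: "e \<in> F"
      show "0 \<le> s e \<and> s e \<le> up d e \<and> up d e \<le> 1"
        using s[rule_format, OF e] r[OF e] d(3)[rule_format, OF e] by (auto simp: up_def)
    qed
    also note less
    also have "event_prob (lo d) F A \<le> event_prob s' F A"
      using fin _ A
    proof (rule event_prob_mono)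
      fix e assume e: "e \<in> F"
      show "0 \<le> lo d e \<and> lo d e \<le> s' e \<and> s' e \<le> 1"
        using s'[rule_format, OF e] r[OF e] r'[of e] d(3)[rule_format, OF e] e by (auto simp: lo_def)
    qed
    finally show ?thesis by simp
  qed
  show ?thesis
    by (intro exI[of _ d] conjI allI impI, rule d(1), rule main; assumption)
qed

text \<open>
  Comparing two product laws by changing one block after another: it suffices to compare them on each
  block, for every fixed configuration \<open>S'\<close> outside of it.
\<close>

lemma event_prob_blockwise_mono:
  fixes F :: "nat \<Rightarrow> 'e set"
  assumes J: "finite J" "\<And>j. j < N \<Longrightarrow> F j \<subseteq> J" and disj: "\<And>i j. i \<noteq> j \<Longrightarrow> F i \<inter> F j = {}"
    and s: "\<And>e. e \<in> J \<Longrightarrow> 0 \<le> s e \<and> s e \<le> 1 \<and> 0 \<le> s' e \<and> s' e \<le> 1"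
    and off: "\<And>e. e \<in> J \<Longrightarrow> (\<And>j. j < N \<Longrightarrow> e \<notin> F j) \<Longrightarrow> s e \<le> s' e"
    and A: "mono A"
    and blk: "\<And>j S'. j < N \<Longrightarrow> S' \<subseteq> J - F j \<Longrightarrow>
      event_prob s (F j) (\<lambda>S. A (S \<union> S')) \<le> event_prob s' (F j) (\<lambda>S. A (S \<union> S'))"
  shows "event_prob s J A \<le> event_prob s' J A"
proof -
  \<comment> \<open>The hybrid law with the first \<open>k\<close> blocks already changed.\<close>
  define h where "h k e = (if \<exists>j<k. e \<in> F j then s' e else s e)" for k :: nat and e
  have "event_prob s J A \<le> event_prob (h k) J A" if "k \<le> N" for k
    using that
  proof (induction k)
    case 0
    have "h 0 = s" by (simp add: h_def fun_eq_iff)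
    then show ?case by simp
  next
    case (Suc k)
    have "finite (F k)" using J Suc.prems finite_subset by (metis Suc_le_eq)
    then have split: "event_prob (h k') J A = (\<Sum>S'\<in>Pow (J - F k).
        config_weight (h k') (J - F k) S' * event_prob (h k') (F k) (\<lambda>S. A (S \<union> S')))" for k'
      using event_prob_Un[of "F k" "J - F k" "h k'" A] J Suc.prems
      by (simp add: Un_absorb1)
    have hk: "h k e = s e" "h (Suc k) e = s' e" if "e \<in> F k" for e
    proof -
      have "e \<notin> F j" if "j < k" for j
        using disj[of j k] \<open>e \<in> F k\<close> that by auto
      then show "h k e = s e" "h (Suc k) e = s' e" using that by (auto simp: h_def)
    qed
    have hk': "h k e = h (Suc k) e" if "e \<notin> F k" for e
      using that by (auto simp: h_def less_Suc_eq)
    have "event_prob (h k) J A \<le> event_prob (h (Suc k)) J A"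
      unfolding split
    proof (rule sum_mono)
      fix S' assume S': "S' \<in> Pow (J - F k)"
      have 1: "config_weight (h k) (J - F k) S' = config_weight (h (Suc k)) (J - F k) S'"
        unfolding config_weight_def using hk' by (intro prod.cong) auto
      have 2: "event_prob (h k) (F k) (\<lambda>S. A (S \<union> S')) = event_prob s (F k) (\<lambda>S. A (S \<union> S'))"
        "event_prob (h (Suc k)) (F k) (\<lambda>S. A (S \<union> S')) = event_prob s' (F k) (\<lambda>S. A (S \<union> S'))"
        by (rule event_prob_cong; simp add: hk)+
      show "config_weight (h k) (J - F k) S' * event_prob (h k) (F k) (\<lambda>S. A (S \<union> S'))
        \<le> config_weight (h (Suc k)) (J - F k) S' * event_prob (h (Suc k)) (F k) (\<lambda>S. A (S \<union> S'))"
        unfolding 1 2 using S' Suc.prems s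
        by (intro mult_left_mono blk config_weight_nonneg) (auto simp: h_def)
    qed
    with Suc show ?case by simp
  qed
  from this[of N] have "event_prob s J A \<le> event_prob (h N) J A" by simp
  also have "\<dots> \<le> event_prob s' J A"
    using J(1) _ A
  proof (rule event_prob_mono)
    fix e assume e: "e \<in> J"
    show "0 \<le> h N e \<and> h N e \<le> s' e \<and> s' e \<le> 1"
      using s[OF e] off[OF e] by (auto simp: h_def)
  qed
  finally show ?thesis .
qed

section \<open>Locality of reaching a level\<close>

lemma block_subset_ladder_edges: "block E B n l \<subseteq> ladder_edges E"
  by (auto simp: block_def ladder_edges_def)

text \<open>
  Only edges at the end of some walk of \<open>j < l\<close> steps from \<open>x\<close> matter for reaching height \<open>n + l\<close>
  from \<open>(x, n)\<close>.
\<close>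

lemma reaches_restrict:
  assumes B: "\<And>j. (adjacency E ^^ j) `` {x} \<subseteq> B j" and W: "W' \<subseteq> W"
    and "\<And>j. j < l \<Longrightarrow> W \<inter> block E (B j) n l \<subseteq> W'"
  shows "reaches E x n l W' \<longleftrightarrow> reaches E x n l W"
proof
  assume "reaches E x n l W'"
  with W show "reaches E x n l W" by (rule mono_eventD[OF mono_reaches])
next
  have "(x, y) \<in> level_conn E W' n j" if "(x, y) \<in> level_conn E W n j" "j \<le> l" for j y
    using that
  proof (induction j arbitrary: y)
    case (Suc j)
    then obtain z where z: "(x, z) \<in> level_conn E W n j" "(z, y) \<in> level_step E W (n + int j)" by auto
    have "z \<in> B j" using z(1) level_conn_subset_adjacency[of E W n j] B[of j] by blast
    moreover have "{z, y} \<in> E" "((z, n + int j), (y, n + int j + 1)) \<in> W"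
      using z(2) by (simp_all add: level_step_def)
    ultimately have "((z, n + int j), (y, n + int j + 1)) \<in> W'"
      using assms(3)[of j] Suc.prems(2) by (auto simp: block_iff)
    then have "(z, y) \<in> level_step E W' (n + int j)" using z(2) by (simp add: level_step_def)
    moreover have "(x, z) \<in> level_conn E W' n j" using Suc.IH[OF z(1)] Suc.prems(2) by simp
    ultimately show ?case by auto
  qed simp
  then show "reaches E x n l W \<Longrightarrow> reaches E x n l W'"
    unfolding reaches_def by blast
qed

lemma reaches_finite_support:
  assumes lf: "\<And>a. finite {b. {a, b} \<in> E}" and "finite U"
  shows "\<exists>J. finite J \<and> J \<subseteq> ladder_edges E \<and> block E U n l \<subseteq> J \<and>
      (\<forall>e\<in>J. n \<le> snd (fst e) \<and> snd (fst e) < n + int l) \<and>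
      (\<forall>\<omega>. reaches E x n l {e \<in> J. \<omega> e} \<longleftrightarrow> reaches E x n l {e \<in> ladder_edges E. \<omega> e})"
proof -
  define B where "B = U \<union> (\<Union>j<l. (adjacency E ^^ j) `` {x})"
  define J where "J = block E B n l"
  have "finite B" using \<open>finite U\<close> finite_adjacency_relpow[OF lf] by (simp add: B_def)
  then have J: "finite J" "J \<subseteq> ladder_edges E"
    unfolding J_def by (simp_all only: finite_block[OF lf] block_subset_ladder_edges)
  have "reaches E x n l {e \<in> J. \<omega> e} \<longleftrightarrow> reaches E x n l {e \<in> ladder_edges E. \<omega> e}" for \<omega>
  proof (rule reaches_restrict)
    fix j assume "j < l"
    then show "{e \<in> ladder_edges E. \<omega> e} \<inter> block E ((adjacency E ^^ j) `` {x}) n l \<subseteq> {e \<in> J. \<omega> e}"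
      unfolding J_def B_def block_def by blast
  qed (use J in auto)
  moreover have "block E U n l \<subseteq> J" "\<forall>e\<in>J. n \<le> snd (fst e) \<and> snd (fst e) < n + int l"
    unfolding J_def B_def block_def by auto
  ultimately show ?thesis using J by (intro exI[of _ J] conjI allI)
qed


section \<open>Almost sure events and measurability in infinite products\<close>

text \<open>
  Independent events whose probabilities are bounded away from one do not all occur, almost surely.
\<close>

lemma AE_cylinder:
  fixes F :: "nat \<Rightarrow> 'e set"
  assumes fin: "\<And>j. finite (F j)" and disj: "\<And>i j. i \<noteq> j \<Longrightarrow> F i \<inter> F j = {}" and I: "\<And>j. F j \<subseteq> I"
    and r: "\<And>e. e \<in> I \<Longrightarrow> 0 \<le> r e \<and> r e \<le> 1"
    and c: "\<And>j. event_prob r (F j) (A j) \<le> c" and "0 \<le> c" "c < 1"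
  shows "AE \<omega> in bernoulli_product I r. \<exists>j. \<not> A j {e \<in> F j. \<omega> e}"
proof -
  let ?M = "bernoulli_product I r"
  interpret product_prob_space "\<lambda>e. measure_pmf (bernoulli_pmf (r e))" I
    by (intro product_prob_spaceI prob_space_measure_pmf)
  define B where "B L = (\<lambda>S. \<forall>j<L. A j (S \<inter> F j))" for L :: nat
  define N where "N L = {\<omega> \<in> I \<rightarrow>\<^sub>E UNIV. B L {e \<in> (\<Union>j<L. F j). \<omega> e}}" for L :: nat
  have J: "finite (\<Union>j<L. F j)" "(\<Union>j<L. F j) \<subseteq> I" for L
    using fin I by auto
  have N: "N L \<in> sets ?M" for L
    unfolding N_def by (rule sets_cylinder[OF J]) (rule r, use I in auto)
  have mN: "measure ?M (N L) \<le> c ^ L" for L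
  proof -
    have "measure ?M (N L) = event_prob r (\<Union>j<L. F j) (B L)"
      unfolding N_def by (rule measure_cylinder[OF J]) (rule r, use I in auto)
    also have "\<dots> \<le> c ^ L"
      unfolding B_def
    proof (rule event_prob_blocks_le[OF fin disj _ c \<open>0 \<le> c\<close>])
      show "0 \<le> r e \<and> r e \<le> 1" if "e \<in> F j" for e j
        using r I that by blast
    qed
    finally show ?thesis .
  qed
  have "(\<Inter>L. N L) \<in> sets ?M" using N by auto
  moreover have "measure ?M (\<Inter>L. N L) \<le> 0"
  proof (rule LIMSEQ_le_const)
    show "(\<lambda>L. c ^ L) \<longlonglongrightarrow> 0" using \<open>0 \<le> c\<close> \<open>c < 1\<close> by (intro LIMSEQ_realpow_zero)
    have "measure ?M (\<Inter>L. N L) \<le> c ^ L" for L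
    proof -
      have "(\<Inter>L. N L) \<subseteq> N L" by blast
      from finite_measure_mono[OF this N] mN[of L] show ?thesis by linarith
    qed
    then show "\<exists>N'. \<forall>L\<ge>N'. measure ?M (\<Inter>L. N L) \<le> c ^ L" by blast
  qed
  ultimately have null: "(\<Inter>L. N L) \<in> null_sets ?M"
    by (intro null_setsI) (simp_all add: emeasure_eq_measure measure_le_0_iff)
  show ?thesis
  proof (rule AE_I'[OF null], rule subsetI)
    fix \<omega> assume "\<omega> \<in> {\<omega> \<in> space ?M. \<not> (\<exists>j. \<not> A j {e \<in> F j. \<omega> e})}"
    then have \<omega>: "\<omega> \<in> I \<rightarrow>\<^sub>E UNIV" "\<And>j. A j {e \<in> F j. \<omega> e}" by (auto simp: space_PiM)
    have "{e \<in> (\<Union>j<L. F j). \<omega> e} \<inter> F j = {e \<in> F j. \<omega> e}" if "j < L" for j L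
      using that by blast
    then have "\<omega> \<in> N L" for L unfolding N_def B_def using \<omega> by simp
    then show "\<omega> \<in> (\<Inter>L. N L)" by blast
  qed
qed

text \<open>
  Every measurable subset of a product space is determined by countably many coordinates.
\<close>

lemma sets_PiM_countable_support:
  assumes "A \<in> sets (PiM I M)"
  shows "\<exists>I0\<subseteq>I. countable I0 \<and> (\<forall>\<omega>\<in>space (PiM I M). \<forall>\<omega>'\<in>space (PiM I M).
    (\<forall>i\<in>I0. \<omega> i = \<omega>' i) \<longrightarrow> (\<omega> \<in> A \<longleftrightarrow> \<omega>' \<in> A))"
proof -
  define supp where "supp I0 a \<longleftrightarrow> I0 \<subseteq> I \<and> countable I0 \<and> (\<forall>\<omega>\<in>space (PiM I M). \<forall>\<omega>'\<in>space (PiM I M).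
    (\<forall>i\<in>I0. \<omega> i = \<omega>' i) \<longrightarrow> (\<omega> \<in> a \<longleftrightarrow> \<omega>' \<in> a))" for I0 a
  have "A \<in> sigma_sets (\<Pi>\<^sub>E i\<in>I. space (M i)) {{f \<in> \<Pi>\<^sub>E i\<in>I. space (M i). f i \<in> A} | i A. i \<in> I \<and> A \<in> sets (M i)}"
    using assms unfolding sets_PiM_single .
  then have "\<exists>I0. supp I0 A"
  proof (induction rule: sigma_sets.induct)
    case (Basic a)
    then obtain i B where a: "a = {f \<in> \<Pi>\<^sub>E i\<in>I. space (M i). f i \<in> B}" "i \<in> I" by blast
    then have "supp {i} a" unfolding supp_def space_PiM by simp
    then show ?case ..
  next
    case Empty
    have "supp {} {}" unfolding supp_def by simp
    then show ?case ..
  next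
    case (Compl a)
    from Compl(2) obtain I0 where "supp I0 a" ..
    then have "supp I0 ((\<Pi>\<^sub>E i\<in>I. space (M i)) - a)" unfolding supp_def space_PiM by blast
    then show ?case ..
  next
    case (Union a)
    have "\<forall>n. \<exists>I0. supp I0 (a n)" using Union(2) by (intro allI)
    from choice[OF this] obtain I0 where I0: "\<forall>n. supp (I0 n) (a n)" ..
    have "supp (\<Union>n. I0 n) (\<Union>n. a n)"
      unfolding supp_def
    proof (intro conjI ballI impI)
      fix \<omega> \<omega>' assume \<omega>: "\<omega> \<in> space (PiM I M)" "\<omega>' \<in> space (PiM I M)"
        "\<forall>i\<in>(\<Union>n. I0 n). \<omega> i = \<omega>' i"
      have "\<omega> \<in> a n \<longleftrightarrow> \<omega>' \<in> a n" for n
      proof -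
        have "\<forall>i\<in>I0 n. \<omega> i = \<omega>' i" using \<omega>(3) by blast
        with I0[rule_format, of n] \<omega>(1,2) show ?thesis unfolding supp_def by blast
      qed
      then show "\<omega> \<in> (\<Union>n. a n) \<longleftrightarrow> \<omega>' \<in> (\<Union>n. a n)" by blast
    qed (use I0 in \<open>auto simp: supp_def\<close>)
    then show ?case ..
  qed
  then show ?thesis unfolding supp_def .
qed

section \<open>The ladder graph with distinguished columns\<close>

text \<open>
  A connected graph with finitely many distinguished edges \<open>{u i, v i}\<close>.
\<close>

locale ladder_columns =
  fixes V :: "'a set" and E :: "'a set set" and u v :: "'k::finite \<Rightarrow> 'a"
  assumes graph: "connected_graph V E"
    and columns: "\<And>i. {u i, v i} \<in> E"
    and distinct: "inj (\<lambda>i. {u i, v i})"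
begin

text \<open>
  The set of distinguished edges; \<open>ladder_edges D\<close> is the union of their columns.
\<close>

definition D :: "'a set set" where
  "D = range (\<lambda>i. {u i, v i})"

abbreviation law :: "real ^ 'k \<Rightarrow> real \<Rightarrow> ('a ladder_edge \<Rightarrow> bool) measure" where
  "law \<equiv> percolation_measure E u v"

text \<open>
  The event that \<open>(x, n)\<close> reaches height \<open>n + l\<close>.
\<close>

definition reach_event :: "'a \<Rightarrow> int \<Rightarrow> nat \<Rightarrow> ('a ladder_edge \<Rightarrow> bool) set" where
  "reach_event x n l = {\<omega> \<in> ladder_edges E \<rightarrow>\<^sub>E UNIV. reaches E x n l {e \<in> ladder_edges E. \<omega> e}}"

text \<open>
  The event that \<open>(x, n)\<close> reaches every level. In a locally finite graph this says that its forward
  cluster is infinite.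
\<close>

definition percolates :: "'a \<Rightarrow> int \<Rightarrow> ('a ladder_edge \<Rightarrow> bool) set" where
  "percolates x n = (\<Inter>l. reach_event x n l)"

text \<open>
  Vertical translation, which preserves all edge probabilities.
\<close>

definition shift :: "int \<Rightarrow> 'a ladder_edge \<Rightarrow> 'a ladder_edge" where
  "shift m e = ((fst (fst e), snd (fst e) + m), (fst (snd e), snd (snd e) + m))"

lemma D_subset: "D \<subseteq> E"
  unfolding D_def by (rule image_subsetI) (rule columns)

lemma finite_D: "finite D"
  by (simp add: D_def)

lemma D_pair: "e \<in> D \<Longrightarrow> \<exists>a b. e = {a, b}"
  unfolding D_def by (elim rangeE) (intro exI)

lemma finite_UD: "finite (\<Union>D)"
  by (auto simp: D_def)

lemma E_V: "\<Union>E \<subseteq> V"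
proof
  fix x assume "x \<in> \<Union>E"
  then obtain e where e: "e \<in> E" "x \<in> e" by blast
  with graph have "\<exists>a\<in>V. \<exists>b\<in>V. a \<noteq> b \<and> e = {a, b}" unfolding connected_graph_def by simp
  with e(2) show "x \<in> V" by auto
qed

lemma ladder_column_iff: "((a, s), (b, s + 1)) \<in> ladder_column x y \<longleftrightarrow> {a, b} = {x, y}"
  by (auto simp: ladder_column_def doubleton_eq_iff)

lemma edge_prob_column:
  assumes "{a, b} = {u i, v i}"
  shows "edge_prob u v q p ((a, s), (b, s + 1)) = q $ i"
proof -
  have "(THE j. ((a, s), (b, s + 1)) \<in> ladder_column (u j) (v j)) = i"
  proof (rule the_equality)
    show "((a, s), (b, s + 1)) \<in> ladder_column (u i) (v i)"
      unfolding ladder_column_iff by (rule assms)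
    fix j assume "((a, s), (b, s + 1)) \<in> ladder_column (u j) (v j)"
    then have "{u j, v j} = {u i, v i}" unfolding ladder_column_iff assms by (rule sym)
    then show "j = i" by (rule injD[OF distinct])
  qed
  moreover have "\<exists>j. ((a, s), (b, s + 1)) \<in> ladder_column (u j) (v j)"
    unfolding ladder_column_iff using assms by blast
  ultimately show ?thesis unfolding edge_prob_def by simp
qed

lemma edge_prob_outside:
  assumes "{a, b} \<notin> D"
  shows "edge_prob u v q p ((a, s), (b, s + 1)) = p"
proof -
  have "\<not> (\<exists>j. ((a, s), (b, s + 1)) \<in> ladder_column (u j) (v j))"
    unfolding ladder_column_iff using assms by (auto simp: D_def)
  then show ?thesis unfolding edge_prob_def by (simp only: if_False)
qed

lemma edge_prob_distinguished:
  assumes "e \<in> ladder_edges D"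
  obtains i where "\<And>q p. edge_prob u v q p e = q $ i"
proof -
  from assms obtain a b s where e: "e = ((a, s), (b, s + 1))" "{a, b} \<in> D"
    by (auto simp: ladder_edges_def)
  then obtain i where "{a, b} = {u i, v i}" by (auto simp: D_def)
  with e(1) edge_prob_column[of a b i] that[of i] show thesis by simp
qed

lemma edge_prob_other:
  assumes "e \<in> ladder_edges E" "e \<notin> ladder_edges D"
  shows "edge_prob u v q p e = p"
proof -
  from assms(1) obtain a b s where e: "e = ((a, s), (b, s + 1))" by (auto simp: ladder_edges_def)
  with assms(2) have "{a, b} \<notin> D" by (auto simp: ladder_edges_def)
  with e edge_prob_outside show ?thesis by simp
qed

lemma edge_prob_bounds:
  assumes "\<And>i. 0 \<le> q $ i \<and> q $ i \<le> 1" "0 \<le> p" "p \<le> 1" "e \<in> ladder_edges E"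
  shows "0 \<le> edge_prob u v q p e \<and> edge_prob u v q p e \<le> 1"
proof (cases "e \<in> ladder_edges D")
  case True
  then obtain i where "\<And>q p. edge_prob u v q p e = q $ i" using edge_prob_distinguished by blast
  then show ?thesis using assms(1) by simp
next
  case False
  then show ?thesis using edge_prob_other assms by simp
qed

lemma shift_pair: "shift m ((a, s), (b, s + 1)) = ((a, s + m), (b, (s + m) + 1))"
  by (simp add: shift_def)

lemma inj_shift: "inj_on (shift m) A"
  by (auto simp: inj_on_def shift_def prod_eq_iff)

lemma shift_ladder_edges: "shift m e \<in> ladder_edges F \<longleftrightarrow> e \<in> ladder_edges F"
proof -
  obtain a s b t where e: "e = ((a, s), (b, t))" by (metis surj_pair)
  show ?thesis unfolding e shift_def ladder_edges_def by auto
qed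

lemma block_shift: "block F U (n + m) T = shift m ` block F U n T"
proof (intro equalityI subsetI)
  fix e assume "e \<in> block F U (n + m) T"
  then obtain a b s where e: "e = ((a, s), (b, s + 1))" "{a, b} \<in> F" "a \<in> U \<or> b \<in> U"
    "n + m \<le> s" "s < n + m + int T" unfolding block_def by blast
  have "e = shift m ((a, s - m), (b, (s - m) + 1))" using e(1) by (simp add: shift_def)
  moreover have "((a, s - m), (b, (s - m) + 1)) \<in> block F U n T"
    unfolding block_iff using e by auto
  ultimately show "e \<in> shift m ` block F U n T" by blast
next
  fix e assume "e \<in> shift m ` block F U n T"
  then obtain a b s where e: "e = shift m ((a, s), (b, s + 1))" "{a, b} \<in> F" "a \<in> U \<or> b \<in> U"
    "n \<le> s" "s < n + int T" unfolding block_def by blast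
  then show "e \<in> block F U (n + m) T" unfolding shift_pair e(1) block_iff by auto
qed

lemma block_level: "e \<in> block F U n T \<Longrightarrow> n \<le> snd (fst e) \<and> snd (fst e) < n + int T"
  by (auto simp: block_def)

lemma block_mono:
  assumes "n \<le> n'" "n' + int T' \<le> n + int T"
  shows "block F U n' T' \<subseteq> block F U n T"
proof
  fix e assume "e \<in> block F U n' T'"
  then obtain a b s where e: "e = ((a, s), (b, s + 1))" "{a, b} \<in> F" "a \<in> U \<or> b \<in> U"
    "n' \<le> s" "s < n' + int T'" unfolding block_def by blast
  with assms show "e \<in> block F U n T" unfolding e(1) block_iff by auto
qed

lemma edge_prob_shift:
  assumes "e \<in> ladder_edges E"
  shows "edge_prob u v q p (shift m e) = edge_prob u v q p e"
proof -
  from assms obtain a b s where e: "e = ((a, s), (b, s + 1))" by (auto simp: ladder_edges_def)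
  show ?thesis
  proof (cases "{a, b} \<in> D")
    case True
    then obtain i where i: "{a, b} = {u i, v i}" by (auto simp: D_def)
    show ?thesis unfolding e shift_pair edge_prob_column[OF i] ..
  next
    case False
    show ?thesis unfolding e shift_pair edge_prob_outside[OF False] ..
  qed
qed

section \<open>Comparison of percolation laws\<close>

lemma law_eq: "law q p = bernoulli_product (ladder_edges E) (edge_prob u v q p)"
  by (simp add: percolation_measure_def)

lemma space_law: "space (law q p) = ladder_edges E \<rightarrow>\<^sub>E UNIV"
  unfolding law_eq by (simp add: space_PiM)

lemma sets_law: "sets (law q p) = sets (law q' p')"
  unfolding law_eq by (intro sets_PiM_cong refl) simp

lemma prob_space_law: "prob_space (law q p)"
  unfolding law_eq by (intro prob_space_PiM prob_space_measure_pmf)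

lemma percolates_iff:
  "\<omega> \<in> percolates x n \<longleftrightarrow> \<omega> \<in> ladder_edges E \<rightarrow>\<^sub>E UNIV \<and> (\<forall>l. reaches E x n l {e \<in> ladder_edges E. \<omega> e})"
  unfolding percolates_def reach_event_def by simp

lemma reach_event_antimono:
  assumes "l \<le> l'"
  shows "reach_event x n l' \<subseteq> reach_event x n l"
  unfolding reach_event_def using reaches_antimono[of E x n l "l' - l"] assms by auto

lemma reach_event_sets:
  assumes lf: "\<And>a. finite {b. {a, b} \<in> E}"
    and q: "\<And>i. 0 \<le> q $ i \<and> q $ i \<le> 1" and p: "0 \<le> p" "p \<le> 1"
  shows "reach_event x n l \<in> sets (law q p)"
proof -
  from reaches_finite_support[OF lf finite.emptyI, of n l x] obtain J where J: "finite J" "J \<subseteq> ladder_edges E"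
    "\<forall>\<omega>. reaches E x n l {e \<in> J. \<omega> e} \<longleftrightarrow> reaches E x n l {e \<in> ladder_edges E. \<omega> e}"
    by (elim exE conjE)
  have "{\<omega> \<in> ladder_edges E \<rightarrow>\<^sub>E UNIV. reaches E x n l {e \<in> J. \<omega> e}} \<in> sets (law q p)"
    unfolding law_eq using J(1,2) by (rule sets_cylinder) (use edge_prob_bounds[OF q p] J(2) in blast)
  then show ?thesis unfolding reach_event_def J(3)[rule_format] .
qed

lemma percolates_mono_law:
  assumes lf: "\<And>a. finite {b. {a, b} \<in> E}"
    and q: "\<And>i. 0 \<le> q $ i \<and> q $ i \<le> 1" and p: "0 \<le> p" "p \<le> 1"
    and q': "\<And>i. 0 \<le> q' $ i \<and> q' $ i \<le> 1" and p': "0 \<le> p'" "p' \<le> 1"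
    and "0 < T"
    and le: "\<And>m. measure (law q p) (reach_event x n (m * T)) \<le> measure (law q' p') (reach_event x n (m * T))"
  shows "measure (law q p) (percolates x n) \<le> measure (law q' p') (percolates x n)"
proof -
  let ?R = "\<lambda>m. reach_event x n (m * T)"
  have eq: "percolates x n = (\<Inter>m. ?R m)"
  proof
    show "(\<Inter>m. ?R m) \<subseteq> percolates x n"
      unfolding percolates_def
    proof (rule INT_greatest)
      fix l
      have "?R l \<subseteq> reach_event x n l" using \<open>0 < T\<close> by (intro reach_event_antimono) simp
      then show "(\<Inter>m. ?R m) \<subseteq> reach_event x n l" by blast
    qed
  qed (auto simp: percolates_def)
  have dec: "decseq ?R"
    by (intro antimonoI reach_event_antimono mult_le_mono1)
  interpret P: prob_space "law q p" by (rule prob_space_law)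
  interpret P': prob_space "law q' p'" by (rule prob_space_law)
  have "(\<lambda>m. measure (law q p) (?R m)) \<longlonglongrightarrow> measure (law q p) (percolates x n)"
    unfolding eq using dec reach_event_sets[OF lf q p] by (intro P.finite_Lim_measure_decseq) auto
  moreover have "(\<lambda>m. measure (law q' p') (?R m)) \<longlonglongrightarrow> measure (law q' p') (percolates x n)"
    unfolding eq using dec reach_event_sets[OF lf q' p'] by (intro P'.finite_Lim_measure_decseq) auto
  ultimately show ?thesis by (rule LIMSEQ_le) (use le in blast)
qed

text \<open>
  The heart of the argument: raising \<open>p\<close> to \<open>p'\<close> outweighs every sufficiently small change of the
  column parameters. The bound \<open>d\<close> comes from a single block; translation invariance and the blockwise
  comparison carry it to all heights.
\<close>

lemma percolates_comparison:
  assumes lf: "\<And>a. finite {b. {a, b} \<in> E}" and inf: "infinite V"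
    and q: "\<And>i. 0 < q $ i \<and> q $ i < 1" and p: "0 < p" "p < p'" "p' \<le> 1"
  shows "\<exists>d>0. \<forall>q1 q2 p1. (\<forall>i. 0 \<le> q1 $ i \<and> q1 $ i \<le> 1 \<and> \<bar>q1 $ i - q $ i\<bar> \<le> d) \<longrightarrow>
    (\<forall>i. 0 \<le> q2 $ i \<and> q2 $ i \<le> 1 \<and> \<bar>q2 $ i - q $ i\<bar> \<le> d) \<longrightarrow> p' \<le> p1 \<longrightarrow> p1 \<le> 1 \<longrightarrow>
    (\<forall>x n. measure (law q2 p) (percolates x n) \<le> measure (law q1 p1) (percolates x n))"
proof -
  let ?U = "\<Union>D" and ?Q = "ladder_edges D"
  from walk_parity[OF finite_D D_pair] obtain L where
    L: "\<forall>x\<in>?U. \<forall>y l l'. (x, y) \<in> adjacency D ^^ l \<longrightarrow> L \<le> l' \<longrightarrow> even (l + l') \<longrightarrow> (x, y) \<in> adjacency D ^^ l'" ..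
  define T where "T = 2 * L + 3"
  let ?F = "block E ?U 0 T"
  have esc: "\<forall>x\<in>?U. \<exists>d w z. (x, w) \<in> adjacency D ^^ d \<and> {w, z} \<in> E - D"
    by (intro ballI finite_set_escape[OF graph inf finite_D D_subset])
  have finF: "finite (block E ?U n T)" for n by (rule finite_block[OF lf finite_UD])
  have FE: "e \<in> block E ?U n T \<Longrightarrow> e \<in> ladder_edges E" for e n
    using block_subset_ladder_edges[of E ?U n T] by blast
  let ?r = "edge_prob u v q p" and ?r' = "edge_prob u v q p'"
  have "\<exists>d>0. \<forall>A s s'. mono A \<longrightarrow>
    (\<forall>S\<subseteq>?F. A S = A {}) \<or> (\<exists>g\<in>?F - ?Q. \<exists>S\<subseteq>?F. \<not> A S \<and> A (insert g S)) \<longrightarrow>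
    (\<forall>e\<in>?F. 0 \<le> s e \<and> s e \<le> (if e \<in> ?Q then ?r e + d else ?r e)) \<longrightarrow>
    (\<forall>e\<in>?F. (if e \<in> ?Q then ?r e - d else ?r' e) \<le> s' e \<and> s' e \<le> 1) \<longrightarrow>
    event_prob s ?F A \<le> event_prob s' ?F A"
  proof (rule block_domination)
    show "finite ?F" by (rule finF)
    fix e assume e: "e \<in> ?F"
    show "0 < ?r e \<and> ?r e < 1"
    proof (cases "e \<in> ?Q")
      case True
      then obtain i where "\<And>q p. edge_prob u v q p e = q $ i" using edge_prob_distinguished by blast
      then show ?thesis using q by simp
    next
      case False
      then show ?thesis using edge_prob_other[OF FE[OF e] False] p by simp
    qed
  next
    fix e assume e: "e \<in> ?F - ?Q"
    then have "e \<in> ladder_edges E" "e \<notin> ?Q" using FE[of e 0] by simp_all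
    then show "?r e < ?r' e \<and> ?r' e \<le> 1" using edge_prob_other[of e] p by simp
  qed
  then obtain d where "d > 0" and d: "\<forall>A s s'. mono A \<longrightarrow>
    (\<forall>S\<subseteq>?F. A S = A {}) \<or> (\<exists>g\<in>?F - ?Q. \<exists>S\<subseteq>?F. \<not> A S \<and> A (insert g S)) \<longrightarrow>
    (\<forall>e\<in>?F. 0 \<le> s e \<and> s e \<le> (if e \<in> ?Q then ?r e + d else ?r e)) \<longrightarrow>
    (\<forall>e\<in>?F. (if e \<in> ?Q then ?r e - d else ?r' e) \<le> s' e \<and> s' e \<le> 1) \<longrightarrow>
    event_prob s ?F A \<le> event_prob s' ?F A" by (elim exE conjE)
  note d = d[THEN spec, THEN spec, THEN spec, THEN mp, THEN mp, THEN mp, THEN mp]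
  have main: "measure (law q2 p) (percolates x n) \<le> measure (law q1 p1) (percolates x n)"
    if q1: "\<And>i. 0 \<le> q1 $ i \<and> q1 $ i \<le> 1 \<and> \<bar>q1 $ i - q $ i\<bar> \<le> d"
      and q2: "\<And>i. 0 \<le> q2 $ i \<and> q2 $ i \<le> 1 \<and> \<bar>q2 $ i - q $ i\<bar> \<le> d"
      and p1: "p' \<le> p1" "p1 \<le> 1" for q1 q2 p1 x n
  proof (rule percolates_mono_law[OF lf])
    show "0 < T" by (simp add: T_def)
    fix m
    let ?s = "edge_prob u v q2 p" and ?s' = "edge_prob u v q1 p1"
    let ?A = "reaches E x n (m * T)"
    from reaches_finite_support[OF lf finite_UD, of n "m * T" x] obtain J where J: "finite J" "J \<subseteq> ladder_edges E"
      "block E ?U n (m * T) \<subseteq> J" "\<forall>e\<in>J. n \<le> snd (fst e) \<and> snd (fst e) < n + int (m * T)"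
      "\<forall>\<omega>. ?A {e \<in> J. \<omega> e} \<longleftrightarrow> ?A {e \<in> ladder_edges E. \<omega> e}" by (elim exE conjE)
    have s: "0 \<le> ?s e \<and> ?s e \<le> 1" "0 \<le> ?s' e \<and> ?s' e \<le> 1" if "e \<in> ladder_edges E" for e
      using edge_prob_bounds[of q2 p e] edge_prob_bounds[of q1 p1 e] q1 q2 p p1 that by simp_all
    let ?B = "\<lambda>j. block E ?U (n + int (j * T)) T"
    have prob_le: "event_prob ?s J ?A \<le> event_prob ?s' J ?A"
    proof (rule event_prob_blockwise_mono[where F = ?B and N = m])
      show "finite J" by (rule J(1))
      show "mono ?A" by (rule mono_reaches)
      show "0 \<le> ?s e \<and> ?s e \<le> 1 \<and> 0 \<le> ?s' e \<and> ?s' e \<le> 1" if "e \<in> J" for e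
        using s J(2) that by blast
      show "?B j \<subseteq> J" if "j < m" for j
      proof -
        have "int (j * T) + int T \<le> int (m * T)"
          using mult_le_mono1[of "Suc j" m T] that by (simp only: of_nat_add[symmetric] of_nat_le_iff) simp
        then have "?B j \<subseteq> block E ?U n (m * T)" by (intro block_mono) simp_all
        with J(3) show ?thesis by blast
      qed
      show "?B i \<inter> ?B j = {}" if "i \<noteq> j" for i j
      proof -
        have "\<not> (n + int (i * T) \<le> s \<and> s < n + int (i * T) + int T \<and> n + int (j * T) \<le> s \<and> s < n + int (j * T) + int T)" for s
        proof
          assume "n + int (i * T) \<le> s \<and> s < n + int (i * T) + int T \<and> n + int (j * T) \<le> s \<and> s < n + int (j * T) + int T"
          then have "i * T < j * T + T" "j * T < i * T + T" by linarith+
          then have "i * T < Suc j * T" "j * T < Suc i * T" by simp_all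
          then show False using that by (simp only: mult_less_cancel2) simp
        qed
        then show ?thesis
          using block_level[of _ E ?U "n + int (i * T)" T] block_level[of _ E ?U "n + int (j * T)" T] by blast
      qed
      show "?s e \<le> ?s' e" if e: "e \<in> J" "\<And>j. j < m \<Longrightarrow> e \<notin> ?B j" for e
      proof -
        have "e \<notin> ?Q"
        proof
          assume "e \<in> ?Q"
          then obtain a b t where ab: "e = ((a, t), (b, t + 1))" "{a, b} \<in> D" by (auto simp: ladder_edges_def)
          define j where "j = nat (t - n) div T"
          have t: "n \<le> t" "t < n + int (m * T)" using J(4) e(1) ab(1) by force+
          then have nt: "nat (t - n) < m * T" by linarith
          have "0 < T" by (simp add: T_def)
          then have "j < m" using nt by (simp add: j_def less_mult_imp_div_less)
          moreover have "j * T \<le> nat (t - n)" "nat (t - n) < j * T + T"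
            using dividend_less_div_times[OF \<open>0 < T\<close>, of "nat (t - n)"] by (simp_all add: j_def)
          then have "n + int (j * T) \<le> t" "t < n + int (j * T) + int T" using t(1) by linarith+
          then have "e \<in> ?B j" unfolding ab(1) block_iff using ab(2) D_subset by auto
          ultimately show False using e(2) by blast
        qed
        then have "?s e = p" "?s' e = p1" using edge_prob_other J(2) e(1) by blast+
        then show ?thesis using p p1 by simp
      qed
      show "event_prob ?s (?B j) (\<lambda>S. ?A (S \<union> S')) \<le> event_prob ?s' (?B j) (\<lambda>S. ?A (S \<union> S'))"
        if j: "j < m" and S': "S' \<subseteq> J - ?B j" for j S'
      proof -
        \<comment> \<open>Translate to the block at height \<open>0\<close>, to which \<open>d\<close> refers.\<close>
        let ?k = "n + int (j * T)"
        have Bj: "?B j = shift ?k ` ?F" using block_shift[of E ?U 0 ?k T] by simp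
        define A' where "A' S = ?A (shift ?k ` S \<union> S')" for S
        have prob: "event_prob (edge_prob u v q3 p3) (?B j) (\<lambda>S. ?A (S \<union> S')) = event_prob (edge_prob u v q3 p3) ?F A'" for q3 p3
          unfolding Bj event_prob_image[OF finF inj_shift]
          by (rule event_prob_cong) (simp_all add: edge_prob_shift[OF FE] A'_def)
        have "mono A'"
        proof (intro monoI le_boolI)
          fix S S2 :: "'a ladder_edge set" assume SS: "S \<subseteq> S2" "A' S"
          have "shift ?k ` S \<union> S' \<subseteq> shift ?k ` S2 \<union> S'" using SS(1) by blast
          from mono_eventD[OF mono_reaches this] SS(2) show "A' S2" unfolding A'_def by blast
        qed
        moreover have "(\<forall>S\<subseteq>?F. A' S = A' {}) \<or> (\<exists>g\<in>?F - ?Q. \<exists>S\<subseteq>?F. \<not> A' S \<and> A' (insert g S))"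
        proof -
          have "Suc j \<le> m" using j by simp
          then have mT: "m * T = j * T + T + (m - Suc j) * T"
            by (metis add.commute add_mult_distrib le_add_diff_inverse mult_Suc)
          have "(\<forall>S\<subseteq>?B j. ?A (S \<union> S') = ?A ({} \<union> S')) \<or>
              (\<exists>g\<in>?B j - ?Q. \<exists>S\<subseteq>?B j. \<not> ?A (S \<union> S') \<and> ?A (insert g S \<union> S'))"
            unfolding mT unfolding T_def
            by (rule block_dichotomy[OF D_subset D_pair _ L esc]) (use S' finF in \<open>auto simp: T_def\<close>)
          then show ?thesis
          proof
            assume const: "\<forall>S\<subseteq>?B j. ?A (S \<union> S') = ?A ({} \<union> S')"
            have "A' S = A' {}" if "S \<subseteq> ?F" for S
            proof -
              have "shift ?k ` S \<subseteq> ?B j" unfolding Bj using that by blast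
              from const[rule_format, OF this] show ?thesis unfolding A'_def by simp
            qed
            then show ?thesis by blast
          next
            assume "\<exists>g\<in>?B j - ?Q. \<exists>S\<subseteq>?B j. \<not> ?A (S \<union> S') \<and> ?A (insert g S \<union> S')"
            then obtain g S where gS: "g \<in> ?B j" "g \<notin> ?Q" "S \<subseteq> ?B j" "\<not> ?A (S \<union> S')" "?A (insert g S \<union> S')"
              by (elim bexE exE conjE DiffE)
            from gS(1) obtain g0 where g0: "g0 \<in> ?F" "g = shift ?k g0" unfolding Bj by blast
            from gS(3) obtain S0 where S0: "S0 \<subseteq> ?F" "S = shift ?k ` S0" unfolding Bj by (auto simp: subset_image_iff)
            have "\<not> A' S0" "A' (insert g0 S0)" using gS(4,5) unfolding A'_def g0(2) S0(2) by simp_all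
            moreover have "g0 \<in> ?F - ?Q" using g0 gS(2) shift_ladder_edges by blast
            ultimately show ?thesis using S0(1) by (intro disjI2 bexI[of _ g0] exI[of _ S0] conjI)
          qed
        qed
        moreover have "\<forall>e\<in>?F. 0 \<le> ?s e \<and> ?s e \<le> (if e \<in> ?Q then ?r e + d else ?r e)"
        proof
          fix e assume e: "e \<in> ?F"
          show "0 \<le> ?s e \<and> ?s e \<le> (if e \<in> ?Q then ?r e + d else ?r e)"
          proof (cases "e \<in> ?Q")
            case True
            then obtain i where i: "\<And>q p. edge_prob u v q p e = q $ i" using edge_prob_distinguished by blast
            show ?thesis unfolding i using True q2[of i] by auto
          next
            case False
            then show ?thesis using edge_prob_other[OF FE[OF e] False] p by simp
          qed
        qed
        moreover have "\<forall>e\<in>?F. (if e \<in> ?Q then ?r e - d else ?r' e) \<le> ?s' e \<and> ?s' e \<le> 1"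
        proof
          fix e assume e: "e \<in> ?F"
          show "(if e \<in> ?Q then ?r e - d else ?r' e) \<le> ?s' e \<and> ?s' e \<le> 1"
          proof (cases "e \<in> ?Q")
            case True
            then obtain i where i: "\<And>q p. edge_prob u v q p e = q $ i" using edge_prob_distinguished by blast
            show ?thesis unfolding i using True q1[of i] by auto
          next
            case False
            then show ?thesis using edge_prob_other[OF FE[OF e] False] p1 by simp
          qed
        qed
        ultimately show ?thesis unfolding prob by (rule d)
      qed
    qed
    have meas: "measure (law q3 p3) (reach_event x n (m * T)) = event_prob (edge_prob u v q3 p3) J ?A"
      if "\<And>e. e \<in> ladder_edges E \<Longrightarrow> 0 \<le> edge_prob u v q3 p3 e \<and> edge_prob u v q3 p3 e \<le> 1" for q3 p3
      unfolding reach_event_def law_eq J(5)[rule_format, symmetric]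
      using J(1,2) by (rule measure_cylinder) (use that J(2) in blast)
    show "measure (law q2 p) (reach_event x n (m * T)) \<le> measure (law q1 p1) (reach_event x n (m * T))"
      using prob_le meas[of q2 p, OF s(1)] meas[of q1 p1, OF s(2)] by simp
  qed (use q1 q2 p p1 in auto)
  show ?thesis
  proof (intro exI[of _ d] conjI allI impI)
    show "d > 0" by fact
    fix q1 q2 :: "real ^ 'k" and p1 x n
    assume 1: "\<forall>i. 0 \<le> q1 $ i \<and> q1 $ i \<le> 1 \<and> \<bar>q1 $ i - q $ i\<bar> \<le> d"
      and 2: "\<forall>i. 0 \<le> q2 $ i \<and> q2 $ i \<le> 1 \<and> \<bar>q2 $ i - q $ i\<bar> \<le> d"
      and 3: "p' \<le> p1" "p1 \<le> 1"
    show "measure (law q2 p) (percolates x n) \<le> measure (law q1 p1) (percolates x n)"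
      by (rule main) (use 1 2 3 in simp_all)
  qed
qed

section \<open>Percolation of probability zero\<close>

abbreviation percolation_event :: "('a ladder_edge \<Rightarrow> bool) set" where
  "percolation_event \<equiv> infinite_cluster_event V E"

lemma percolation_event_eq:
  assumes lf: "\<And>a. finite {b. {a, b} \<in> E}"
  shows "percolation_event = (\<Union>(x, n)\<in>V \<times> UNIV. percolates x n)"
proof -
  have "infinite (forward_cluster V E \<omega> (x, n)) \<longleftrightarrow> (\<forall>l. reaches E x n l {e \<in> ladder_edges E. \<omega> e})"
    if "x \<in> V" for \<omega> x n
  proof (rule infinite_forward_cluster_iff[OF E_V that])
    show "finite (level_conn E {e \<in> ladder_edges E. \<omega> e} n l `` {x})" for l
      by (rule finite_subset[OF Image_mono[OF level_conn_subset_adjacency subset_refl]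
            finite_adjacency_relpow[OF lf]])
  qed
  note inf = this
  show ?thesis
  proof (intro equalityI subsetI)
    fix \<omega> assume "\<omega> \<in> percolation_event"
    then have \<omega>: "\<omega> \<in> ladder_edges E \<rightarrow>\<^sub>E UNIV" "\<exists>a\<in>V \<times> UNIV. infinite (forward_cluster V E \<omega> a)"
      unfolding infinite_cluster_event_def ladder_vertices_def by simp_all
    then obtain x n where "x \<in> V" "infinite (forward_cluster V E \<omega> (x, n))" by (elim bexE SigmaE) simp
    with \<omega>(1) inf[of x \<omega> n] have "\<omega> \<in> percolates x n" unfolding percolates_iff by simp
    with \<open>x \<in> V\<close> show "\<omega> \<in> (\<Union>(x, n)\<in>V \<times> UNIV. percolates x n)" by blast
  next
    fix \<omega> assume "\<omega> \<in> (\<Union>(x, n)\<in>V \<times> UNIV. percolates x n)"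
    then obtain x n where "x \<in> V" "\<omega> \<in> percolates x n" by blast
    with inf[of x \<omega> n] show "\<omega> \<in> percolation_event"
      unfolding infinite_cluster_event_def ladder_vertices_def percolates_iff by (intro CollectI conjI bexI[of _ "(x, n)"]) simp_all
  qed
qed

lemma countable_V:
  assumes lf: "\<And>a. finite {b. {a, b} \<in> E}"
  shows "countable V"
proof -
  from graph obtain x where x: "x \<in> V" unfolding connected_graph_def by blast
  have "V \<subseteq> (\<Union>l. (adjacency E ^^ l) `` {x})"
  proof
    fix y assume "y \<in> V"
    with graph x have "(x, y) \<in> (adjacency E)\<^sup>*" unfolding connected_graph_def adjacency_def by simp
    then obtain l where "(x, y) \<in> adjacency E ^^ l" using rtrancl_imp_relpow by metis
    then show "y \<in> (\<Union>l. (adjacency E ^^ l) `` {x})" by blast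
  qed
  moreover have "countable (\<Union>l. (adjacency E ^^ l) `` {x})"
    by (rule countable_UN[OF countableI_type countable_finite[OF finite_adjacency_relpow[OF lf]]])
  ultimately show ?thesis by (rule countable_subset)
qed

lemma percolates_sets:
  assumes lf: "\<And>a. finite {b. {a, b} \<in> E}"
    and q: "\<And>i. 0 \<le> q $ i \<and> q $ i \<le> 1" and p: "0 \<le> p" "p \<le> 1"
  shows "percolates x n \<in> sets (law q p)"
  unfolding percolates_def by (intro sets.countable_INT' image_subsetI reach_event_sets[OF lf q p]) simp_all

lemma null_sets_iff:
  assumes lf: "\<And>a. finite {b. {a, b} \<in> E}"
    and q: "\<And>i. 0 \<le> q $ i \<and> q $ i \<le> 1" and p: "0 \<le> p" "p \<le> 1"
  shows "percolation_event \<in> null_sets (law q p) \<longleftrightarrow> (\<forall>x\<in>V. \<forall>n. measure (law q p) (percolates x n) = 0)"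
proof
  interpret prob_space "law q p" by (rule prob_space_law)
  show "\<forall>x\<in>V. \<forall>n. measure (law q p) (percolates x n) = 0" if null: "percolation_event \<in> null_sets (law q p)"
  proof (intro ballI allI)
    fix x n assume "x \<in> V"
    then have "percolates x n \<subseteq> percolation_event" unfolding percolation_event_eq[OF lf] by blast
    from null_sets_subset[OF null percolates_sets[OF lf q p] this]
    show "measure (law q p) (percolates x n) = 0" by (simp add: measure_eq_0_null_sets)
  qed
  show "percolation_event \<in> null_sets (law q p)" if 0: "\<forall>x\<in>V. \<forall>n. measure (law q p) (percolates x n) = 0"
    unfolding percolation_event_eq[OF lf]
  proof (rule null_sets_UN')
    show "countable (V \<times> (UNIV :: int set))" using countable_V[OF lf] by simp
    fix z assume "z \<in> V \<times> (UNIV :: int set)"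
    then show "(case z of (x, n) \<Rightarrow> percolates x n) \<in> null_sets (law q p)"
      using 0 percolates_sets[OF lf q p] by (cases z) (auto simp: emeasure_eq_measure)
  qed
qed

text \<open>
  No percolation when the open edges are confined to finitely many columns: almost surely some level
  above any given height has no open edge. The graph may be uncountable here; then the configuration
  is first modified outside the countably many coordinates that determine the event.
\<close>

lemma null_sets_finite_support:
  assumes meas: "percolation_event \<in> sets (law q p)"
    and F: "finite F" "F \<subseteq> E"
    and r: "\<And>e. e \<in> ladder_edges E \<Longrightarrow> 0 \<le> edge_prob u v q p e \<and> edge_prob u v q p e \<le> 1"
    and less: "\<And>e. e \<in> ladder_edges F \<Longrightarrow> edge_prob u v q p e < 1"
    and zero: "\<And>e. e \<in> ladder_edges E \<Longrightarrow> e \<notin> ladder_edges F \<Longrightarrow> edge_prob u v q p e = 0"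
  shows "percolation_event \<in> null_sets (law q p)"
proof -
  let ?r = "edge_prob u v q p" and ?U = "\<Union>F"
  interpret prob_space "law q p" by (rule prob_space_law)
  have FE: "ladder_edges F \<subseteq> ladder_edges E" using F(2) by (auto simp: ladder_edges_def)
  have finF: "finite e \<and> (\<exists>a b. e = {a, b})" if "e \<in> F" for e
  proof -
    have "e \<in> E" using F(2) that by blast
    with graph have "\<exists>a\<in>V. \<exists>b\<in>V. a \<noteq> b \<and> e = {a, b}" unfolding connected_graph_def by simp
    then show ?thesis by auto
  qed
  have finU: "finite ?U" using F(1) finF by blast
  define level where "level n = block F ?U n 1" for n
  have level_iff: "((a, s), (b, s + 1)) \<in> level n \<longleftrightarrow> {a, b} \<in> F \<and> s = n" for a b s n
    unfolding level_def block_iff by auto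
  have fin_level: "finite (level n)" for n
    unfolding level_def
  proof (rule finite_block[OF _ finU])
    show "finite {b. {a, b} \<in> F}" for a by (rule finite_subset[OF _ finU]) auto
  qed
  have level_F: "level n \<subseteq> ladder_edges F" for n
    unfolding level_def by (rule block_subset_ladder_edges)
  have level_snd: "e \<in> level n \<Longrightarrow> snd (fst e) = n" for e n
    unfolding level_def using block_level[of e F ?U n 1] by simp
  define c where "c = event_prob ?r (level 0) (\<lambda>S. S \<noteq> {})"
  have c: "event_prob ?r (level n) (\<lambda>S. S \<noteq> {}) = c" for n
  proof -
    have "level n = shift n ` level 0" unfolding level_def using block_shift[of F ?U 0 n 1] by simp
    then have "event_prob ?r (level n) (\<lambda>S. S \<noteq> {}) = event_prob (?r \<circ> shift n) (level 0) (\<lambda>S. shift n ` S \<noteq> {})"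
      using event_prob_image[OF fin_level inj_shift] by simp
    also have "\<dots> = c" unfolding c_def
    proof (rule event_prob_cong)
      fix e assume "e \<in> level 0"
      then have "e \<in> ladder_edges E" using level_F FE by blast
      then show "(?r \<circ> shift n) e = ?r e" by (simp add: edge_prob_shift)
    qed simp
    finally show ?thesis .
  qed
  have "0 \<le> c" unfolding c_def using r level_F FE by (intro event_prob_nonneg) blast
  moreover have "c < 1"
  proof -
    have "0 < (\<Prod>e\<in>level 0. 1 - ?r e)"
    proof (rule prod_pos)
      fix e assume "e \<in> level 0"
      then have "e \<in> ladder_edges F" using level_F by blast
      then show "0 < 1 - ?r e" using less[of e] by simp
    qed
    also have "(\<Prod>e\<in>level 0. 1 - ?r e) = of_bool (\<not> (({} :: 'a ladder_edge set) \<noteq> {})) * config_weight ?r (level 0) {}"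
      by (simp add: config_weight_def)
    also have "\<dots> \<le> (\<Sum>S\<in>Pow (level 0). of_bool (\<not> (S \<noteq> {})) * config_weight ?r (level 0) S)"
      by (rule member_le_sum)
         (use fin_level r level_F FE in \<open>auto intro!: mult_nonneg_nonneg config_weight_nonneg\<close>)
    also have "\<dots> = 1 - c"
      using event_prob_not[OF fin_level, of ?r 0 "\<lambda>S. S \<noteq> {}"] by (simp add: c_def event_prob_def)
    finally show ?thesis by simp
  qed
  ultimately have c01: "0 \<le> c" "c < 1" .
  have "AE \<omega> in law q p. \<exists>j::nat. \<not> {e \<in> level (n + int j). \<omega> e} \<noteq> {}" for n
    unfolding law_eq
  proof (rule AE_cylinder[where F = "\<lambda>j. level (n + int j)" and A = "\<lambda>_ S. S \<noteq> {}" and c = c])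
    show "level (n + int i) \<inter> level (n + int j) = {}" if "i \<noteq> j" for i j
      using level_snd[of _ "n + int i"] level_snd[of _ "n + int j"] that by force
    show "level (n + int j) \<subseteq> ladder_edges E" for j using level_F FE by blast
  qed (use fin_level r c c01 in auto)
  then have cuts: "AE \<omega> in law q p. \<forall>n. \<exists>j::nat. {e \<in> level (n + int j). \<omega> e} = {}"
    unfolding not_not AE_all_countable by blast
  from sets_PiM_countable_support[OF meas[unfolded law_eq]] obtain I0 where I0: "countable I0" "I0 \<subseteq> ladder_edges E"
    "\<forall>\<omega>\<in>space (law q p). \<forall>\<omega>'\<in>space (law q p).
      (\<forall>e\<in>I0. \<omega> e = \<omega>' e) \<longrightarrow> (\<omega> \<in> percolation_event \<longleftrightarrow> \<omega>' \<in> percolation_event)"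
    unfolding law_eq by (elim exE conjE)
  have closed: "AE \<omega> in law q p. \<forall>e\<in>I0 - ladder_edges F. \<not> \<omega> e"
  proof (subst AE_ball_countable)
    show "countable (I0 - ladder_edges F)" using I0(1) by simp
    show "\<forall>e\<in>I0 - ladder_edges F. AE \<omega> in law q p. \<not> \<omega> e"
    proof
      fix e assume e: "e \<in> I0 - ladder_edges F"
      then have J: "finite {e}" "{e} \<subseteq> ladder_edges E" using I0(2) by auto
      have re: "?r e = 0" using e I0(2) zero[of e] by blast
      have s: "{\<omega> \<in> ladder_edges E \<rightarrow>\<^sub>E UNIV. e \<in> {a \<in> {e}. \<omega> a}} \<in> sets (law q p)"
        unfolding law_eq using J by (rule sets_cylinder[where A = "\<lambda>S. e \<in> S"]) (simp add: re)
      have "measure (law q p) {\<omega> \<in> ladder_edges E \<rightarrow>\<^sub>E UNIV. e \<in> {a \<in> {e}. \<omega> a}} = event_prob ?r {e} (\<lambda>S. e \<in> S)"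
        unfolding law_eq using J by (rule measure_cylinder[where A = "\<lambda>S. e \<in> S"]) (simp add: re)
      also have "\<dots> = 0" by (simp add: event_prob_insert re)
      finally have "{\<omega> \<in> ladder_edges E \<rightarrow>\<^sub>E UNIV. e \<in> {a \<in> {e}. \<omega> a}} \<in> null_sets (law q p)"
        using s by (intro null_setsI) (simp_all add: emeasure_eq_measure)
      then show "AE \<omega> in law q p. \<not> \<omega> e"
        by (rule AE_I') (auto simp: space_law)
    qed
  qed
  have "AE \<omega> in law q p. \<omega> \<notin> percolation_event"
    using cuts closed AE_space
  proof eventually_elim
    fix \<omega> assume cut: "\<forall>n. \<exists>j::nat. {e \<in> level (n + int j). \<omega> e} = {}"
      and cl: "\<forall>e\<in>I0 - ladder_edges F. \<not> \<omega> e" and sp: "\<omega> \<in> space (law q p)"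
    define \<omega>' where "\<omega>' e = (if e \<in> ladder_edges E then e \<in> ladder_edges F \<and> \<omega> e else undefined)" for e
    have sp': "\<omega>' \<in> ladder_edges E \<rightarrow>\<^sub>E UNIV" by (auto simp: \<omega>'_def)
    have "\<forall>e\<in>I0. \<omega> e = \<omega>' e" using cl I0(2) by (auto simp: \<omega>'_def)
    with I0(3) sp sp' have iff: "\<omega> \<in> percolation_event \<longleftrightarrow> \<omega>' \<in> percolation_event"
      unfolding space_law by blast
    let ?W = "{e \<in> ladder_edges E. \<omega>' e}"
    have WF: "e \<in> ?W \<Longrightarrow> e \<in> ladder_edges F \<and> \<omega> e" for e by (simp add: \<omega>'_def)
    have "\<not> infinite (forward_cluster V E \<omega>' (x, n))" if "x \<in> V" for x n
    proof -
      have sub: "level_conn E ?W n l `` {x} \<subseteq> insert x ?U" for l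
      proof (cases l)
        case (Suc k)
        have "b \<in> ?U" if "(a, b) \<in> level_step E ?W s" for a b s
          using WF[of "((a, s), (b, s + 1))"] that unfolding level_step_def ladder_edges_iff by auto
        then show ?thesis unfolding Suc level_conn.simps by blast
      qed simp
      then have "finite (level_conn E ?W n l `` {x})" for l
        using finU finite_subset by (metis finite_insert)
      then have "infinite (forward_cluster V E \<omega>' (x, n)) \<longleftrightarrow> (\<forall>l. reaches E x n l ?W)"
        by (rule infinite_forward_cluster_iff[OF E_V that])
      moreover obtain j where j: "{e \<in> level (n + int j). \<omega> e} = {}" using cut by blast
      have "level_step E ?W (n + int j) = {}"
      proof -
        have False if "(a, b) \<in> level_step E ?W (n + int j)" for a b
        proof -
          from that have "((a, n + int j), (b, n + int j + 1)) \<in> ?W" by (simp add: level_step_def)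
          from WF[OF this] have "((a, n + int j), (b, n + int j + 1)) \<in> {e \<in> level (n + int j). \<omega> e}"
            unfolding ladder_edges_iff by (simp add: level_iff)
          then show False using j by blast
        qed
        then show ?thesis by auto
      qed
      then have "\<not> reaches E x n (Suc j) ?W" unfolding reaches_def level_conn.simps by simp
      ultimately show ?thesis by blast
    qed
    then have "\<omega>' \<notin> percolation_event"
      unfolding infinite_cluster_event_def ladder_vertices_def by auto
    with iff show "\<omega> \<notin> percolation_event" by simp
  qed
  then show ?thesis using meas by (simp add: AE_iff_null_sets)
qed

text \<open>
  A vertex of infinite degree almost surely has infinitely many open outgoing edges once \<open>p > 0\<close>.
\<close>

lemma infinite_degree_not_null:
  assumes deg: "infinite {b. {x, b} \<in> E}" and q: "\<And>i. 0 \<le> q $ i \<and> q $ i \<le> 1" and p: "0 < p" "p \<le> 1"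
  shows "percolation_event \<notin> null_sets (law q p)"
proof
  assume null: "percolation_event \<in> null_sets (law q p)"
  interpret prob_space "law q p" by (rule prob_space_law)
  have "infinite ({b. {x, b} \<in> E} - \<Union>D)" using deg finite_UD by (simp add: Diff_infinite_finite)
  then obtain y :: "nat \<Rightarrow> 'a" where y: "inj y" "range y \<subseteq> {b. {x, b} \<in> E} - \<Union>D"
    using infinite_countable_subset by metis
  then have y': "{x, y j} \<in> E" "y j \<notin> \<Union>D" for j by auto
  define e where "e j = ((x, 0 :: int), (y j, 0 + 1 :: int))" for j
  have e: "e j \<in> ladder_edges E" "edge_prob u v q p (e j) = p" for j
  proof -
    show "e j \<in> ladder_edges E" using y' unfolding e_def ladder_edges_iff by simp
    have "{x, y j} \<notin> D" using y'(2)[of j] by auto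
    then show "edge_prob u v q p (e j) = p" unfolding e_def by (rule edge_prob_outside)
  qed
  have "AE \<omega> in law q p. \<exists>j::nat. \<not> {a \<in> {e (m + j)}. \<omega> a} = {}" for m :: nat
    unfolding law_eq
  proof (rule AE_cylinder[where F = "\<lambda>j. {e (m + j)}" and A = "\<lambda>_ S. S = {}" and c = "1 - p"])
    show "{e (m + i)} \<inter> {e (m + j)} = {}" if "i \<noteq> j" for i j
      using that y(1) by (simp add: e_def inj_eq)
    show "event_prob (edge_prob u v q p) {e (m + j)} (\<lambda>S. S = {}) \<le> 1 - p" for j
      by (simp add: event_prob_insert e)
    show "0 \<le> edge_prob u v q p a \<and> edge_prob u v q p a \<le> 1" if "a \<in> ladder_edges E" for a
      using edge_prob_bounds[OF q _ p(2) that] p(1) by simp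
  qed (use e p in simp_all)
  then have "AE \<omega> in law q p. \<forall>m. \<exists>j::nat. \<not> {a \<in> {e (m + j)}. \<omega> a} = {}"
    unfolding AE_all_countable by blast
  moreover have "AE \<omega> in law q p. \<omega> \<notin> percolation_event" using null by (rule AE_not_in)
  ultimately have "AE \<omega> in law q p. False" using AE_space
  proof eventually_elim
    fix \<omega> assume op: "\<forall>m. \<exists>j::nat. \<not> {a \<in> {e (m + j)}. \<omega> a} = {}"
      and not: "\<omega> \<notin> percolation_event" and sp: "\<omega> \<in> space (law q p)"
    have xV: "x \<in> V" using y'(1)[of 0] E_V by blast
    have "infinite {j. \<omega> (e j)}"
      unfolding infinite_nat_iff_unbounded_le
    proof
      fix m
      from op obtain j where "\<not> {a \<in> {e (m + j)}. \<omega> a} = {}" by blast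
      then have "\<omega> (e (m + j))" by auto
      then show "\<exists>n\<ge>m. n \<in> {j. \<omega> (e j)}" by (intro exI[of _ "m + j"]) simp
    qed
    moreover have "inj (\<lambda>j. (y j, 1 :: int))" using y(1) by (simp add: inj_def)
    ultimately have "infinite ((\<lambda>j. (y j, 1 :: int)) ` {j. \<omega> (e j)})"
      by (simp add: finite_image_iff inj_on_def)
    moreover have "(\<lambda>j. (y j, 1 :: int)) ` {j. \<omega> (e j)} \<subseteq> forward_cluster V E \<omega> (x, 0)"
    proof (rule image_subsetI)
      fix j assume "j \<in> {j. \<omega> (e j)}"
      then have "e j \<in> {e \<in> ladder_edges E. \<omega> e}" using e by simp
      then have "(x, y j) \<in> level_conn E {e \<in> ladder_edges E. \<omega> e} 0 1"
        using y'(1)[of j] by (simp add: level_step_def e_def)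
      then have "(y j, 0 + int 1) \<in> forward_cluster V E \<omega> (x, 0)"
        unfolding forward_cluster_eq[OF E_V xV] by blast
      then show "(y j, 1) \<in> forward_cluster V E \<omega> (x, 0)" by simp
    qed
    ultimately have "infinite (forward_cluster V E \<omega> (x, 0))" using finite_subset by blast
    then have "\<omega> \<in> percolation_event"
      using sp xV unfolding infinite_cluster_event_def ladder_vertices_def space_law
      by (intro CollectI conjI bexI[of _ "(x, 0)"]) simp_all
    with not show False ..
  qed
  then show False by simp
qed

section \<open>Continuity of the critical parameter\<close>

text \<open>
  The parameters \<open>p\<close> without percolation, whose supremum is the critical parameter.
\<close>

abbreviation null_params :: "real ^ 'k \<Rightarrow> real set" where
  "null_params q \<equiv> {p \<in> {0..1}. percolation_event \<in> null_sets (law q p)}"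

lemma zero_null_param:
  assumes "percolation_event \<in> sets (law q 0)" and q: "\<And>i. 0 < q $ i \<and> q $ i < 1"
  shows "0 \<in> null_params q"
proof -
  have q': "0 \<le> q $ i \<and> q $ i \<le> 1" for i using q[of i] by simp
  have "percolation_event \<in> null_sets (law q 0)"
    using assms(1) finite_D D_subset
  proof (rule null_sets_finite_support)
    show "0 \<le> edge_prob u v q 0 e \<and> edge_prob u v q 0 e \<le> 1" if "e \<in> ladder_edges E" for e
      using edge_prob_bounds[OF q' _ _ that, of 0] by simp
    fix e
    show "edge_prob u v q 0 e < 1" if D: "e \<in> ladder_edges D"
    proof -
      from D obtain i where "\<And>q p. edge_prob u v q p e = q $ i" using edge_prob_distinguished by blast
      then show ?thesis using q by simp
    qed
    show "edge_prob u v q 0 e = 0" if "e \<in> ladder_edges E" "e \<notin> ladder_edges D"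
      using that by (rule edge_prob_other)
  qed
  then show ?thesis by simp
qed

lemma critical_prob_bounds:
  assumes "percolation_event \<in> sets (law q 0)" and q: "\<And>i. 0 < q $ i \<and> q $ i < 1"
  shows "0 \<le> critical_prob V E u v q" "critical_prob V E u v q \<le> 1"
    and "\<And>p. p \<in> null_params q \<Longrightarrow> p \<le> critical_prob V E u v q"
    and "\<And>x. x < critical_prob V E u v q \<Longrightarrow> \<exists>p\<in>null_params q. x < p"
proof -
  have ne: "null_params q \<noteq> {}" using zero_null_param[OF assms] by blast
  have bdd: "bdd_above (null_params q)" by (rule bdd_aboveI[of _ 1]) simp
  show up: "\<And>p. p \<in> null_params q \<Longrightarrow> p \<le> critical_prob V E u v q"
    unfolding critical_prob_def using bdd by (rule cSup_upper[rotated])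
  show "0 \<le> critical_prob V E u v q" by (rule up[OF zero_null_param[OF assms]])
  show "critical_prob V E u v q \<le> 1"
    unfolding critical_prob_def using ne by (rule cSup_least) simp
  show "\<exists>p\<in>null_params q. x < p" if "x < critical_prob V E u v q" for x
    using that unfolding critical_prob_def by (simp only: less_cSup_iff[OF ne bdd])
qed

lemma critical_prob_finite:
  assumes meas: "percolation_event \<in> sets (law q 0)" and q: "\<And>i. 0 < q $ i \<and> q $ i < 1" and fin: "finite V"
  shows "critical_prob V E u v q = 1"
proof (rule antisym)
  show "critical_prob V E u v q \<le> 1" by (rule critical_prob_bounds[OF meas q])
  have "E \<subseteq> Pow V" using E_V by blast
  then have finE: "finite E" using fin finite_subset by blast
  have q': "0 \<le> q $ i \<and> q $ i \<le> 1" for i using q[of i] by simp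
  show "1 \<le> critical_prob V E u v q"
  proof (rule dense_le_bounded[of 0])
    fix p :: real assume p: "0 < p" "p < 1"
    have "percolation_event \<in> null_sets (law q p)"
      using meas[unfolded sets_law[of q 0 q p]] finE subset_refl
    proof (rule null_sets_finite_support)
      show "0 \<le> edge_prob u v q p e \<and> edge_prob u v q p e \<le> 1" if "e \<in> ladder_edges E" for e
        using edge_prob_bounds[OF q' _ _ that, of p] p by simp
      show "edge_prob u v q p e < 1" if E: "e \<in> ladder_edges E" for e
      proof (cases "e \<in> ladder_edges D")
        case True
        from True obtain i where "\<And>q p. edge_prob u v q p e = q $ i" using edge_prob_distinguished by blast
        then show ?thesis using q by simp
      next
        case False
        then show ?thesis using edge_prob_other[OF E False] p by simp
      qed
    qed simp
    then show "p \<le> critical_prob V E u v q" using p by (intro critical_prob_bounds(3)[OF meas q]) simp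
  qed simp
qed

lemma critical_prob_infinite_degree:
  assumes meas: "percolation_event \<in> sets (law q 0)" and q: "\<And>i. 0 < q $ i \<and> q $ i < 1"
    and deg: "infinite {b. {x, b} \<in> E}"
  shows "critical_prob V E u v q = 0"
proof -
  have q': "0 \<le> q $ i \<and> q $ i \<le> 1" for i using q[of i] by simp
  have "p = 0" if "p \<in> null_params q" for p
    using infinite_degree_not_null[OF deg q', of p] that by force
  then have "null_params q = {0}" using zero_null_param[OF meas q] by blast
  then show ?thesis unfolding critical_prob_def by simp
qed

lemma critical_prob_continuous_at:
  assumes meas: "\<And>q p. percolation_event \<in> sets (law q p)" and lf: "\<And>a. finite {b. {a, b} \<in> E}" and inf: "infinite V"
    and q: "\<And>i. 0 < q $ i \<and> q $ i < 1" and "0 < \<epsilon>"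
  shows "\<exists>d>0. \<forall>q'. (\<forall>i. 0 < q' $ i \<and> q' $ i < 1) \<longrightarrow> (\<forall>i. \<bar>q' $ i - q $ i\<bar> \<le> d) \<longrightarrow>
    \<bar>critical_prob V E u v q' - critical_prob V E u v q\<bar> \<le> \<epsilon>"
proof -
  let ?c = "critical_prob V E u v"
  have transfer: "\<exists>d>0. \<forall>q1 q2. (\<forall>i. 0 < q1 $ i \<and> q1 $ i < 1 \<and> \<bar>q1 $ i - q $ i\<bar> \<le> d) \<longrightarrow>
      (\<forall>i. 0 < q2 $ i \<and> q2 $ i < 1 \<and> \<bar>q2 $ i - q $ i\<bar> \<le> d) \<longrightarrow> p' < ?c q1 \<longrightarrow> p \<le> ?c q2"
    if p: "0 < p" "p < p'" "p' \<le> 1" for p p'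
  proof -
    from percolates_comparison[OF lf inf q p] obtain d where "d > 0" and d:
      "\<forall>q1 q2 p1. (\<forall>i. 0 \<le> q1 $ i \<and> q1 $ i \<le> 1 \<and> \<bar>q1 $ i - q $ i\<bar> \<le> d) \<longrightarrow>
      (\<forall>i. 0 \<le> q2 $ i \<and> q2 $ i \<le> 1 \<and> \<bar>q2 $ i - q $ i\<bar> \<le> d) \<longrightarrow> p' \<le> p1 \<longrightarrow> p1 \<le> 1 \<longrightarrow>
      (\<forall>x n. measure (law q2 p) (percolates x n) \<le> measure (law q1 p1) (percolates x n))"
      by (elim exE conjE)
    show ?thesis
    proof (intro exI[of _ d] conjI allI impI)
      show "d > 0" by fact
      fix q1 q2 :: "real ^ 'k"
      assume q1: "\<forall>i. 0 < q1 $ i \<and> q1 $ i < 1 \<and> \<bar>q1 $ i - q $ i\<bar> \<le> d"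
        and q2: "\<forall>i. 0 < q2 $ i \<and> q2 $ i < 1 \<and> \<bar>q2 $ i - q $ i\<bar> \<le> d" and less: "p' < ?c q1"
      have q1': "0 < q1 $ i \<and> q1 $ i < 1" "0 \<le> q1 $ i \<and> q1 $ i \<le> 1" for i using q1[rule_format, of i] by simp_all
      have q2': "0 < q2 $ i \<and> q2 $ i < 1" "0 \<le> q2 $ i \<and> q2 $ i \<le> 1" for i using q2[rule_format, of i] by simp_all
      from critical_prob_bounds(4)[OF meas q1'(1) less] obtain p1 where
        p1: "p1 \<in> {0..1}" "percolation_event \<in> null_sets (law q1 p1)" "p' < p1" by blast
      have p1': "0 \<le> p1" "p1 \<le> 1" "p' \<le> p1" using p1 by auto
      have le: "measure (law q2 p) (percolates x n) \<le> measure (law q1 p1) (percolates x n)" for x n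
        using d[THEN spec[of _ q1], THEN spec[of _ q2], THEN spec[of _ p1]] q1 q2 p1' by (simp add: less_imp_le)
      have "\<forall>x\<in>V. \<forall>n. measure (law q1 p1) (percolates x n) = 0"
        using p1(2) unfolding null_sets_iff[OF lf q1'(2) p1'(1,2)] .
      then have "\<forall>x\<in>V. \<forall>n. measure (law q2 p) (percolates x n) = 0"
        using le by (metis antisym measure_nonneg)
      moreover have "0 \<le> p" "p \<le> 1" using p by simp_all
      ultimately have "percolation_event \<in> null_sets (law q2 p)"
        by (simp only: null_sets_iff[OF lf q2'(2)])
      then show "p \<le> ?c q2" using p by (intro critical_prob_bounds(3)[OF meas q2'(1)]) simp
    qed
  qed
  have c: "0 \<le> ?c q" "?c q \<le> 1" using critical_prob_bounds[OF meas q] by simp_all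
  have lower: "\<exists>d>0. \<forall>q'. (\<forall>i. 0 < q' $ i \<and> q' $ i < 1) \<longrightarrow> (\<forall>i. \<bar>q' $ i - q $ i\<bar> \<le> d) \<longrightarrow> ?c q - \<epsilon> \<le> ?c q'"
  proof (cases "?c q - \<epsilon> \<le> 0")
    case True
    have "?c q - \<epsilon> \<le> ?c q'" if "\<forall>i. 0 < q' $ i \<and> q' $ i < 1" for q'
      using critical_prob_bounds(1)[OF meas, of q'] that True by force
    then show ?thesis by (intro exI[of _ 1]) simp
  next
    case False
    define p where "p = ?c q - \<epsilon>"
    define p' where "p' = ?c q - \<epsilon> / 2"
    have "0 < p" "p < p'" "p' \<le> 1" "p' < ?c q" using False c \<open>0 < \<epsilon>\<close> by (simp_all add: p_def p'_def)
    from transfer[OF this(1-3)] obtain d where "d > 0" and d: "\<forall>q1 q2. (\<forall>i. 0 < q1 $ i \<and> q1 $ i < 1 \<and> \<bar>q1 $ i - q $ i\<bar> \<le> d) \<longrightarrow>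
      (\<forall>i. 0 < q2 $ i \<and> q2 $ i < 1 \<and> \<bar>q2 $ i - q $ i\<bar> \<le> d) \<longrightarrow> p' < ?c q1 \<longrightarrow> p \<le> ?c q2" by (elim exE conjE)
    have "p \<le> ?c q'" if "\<forall>i. 0 < q' $ i \<and> q' $ i < 1" "\<forall>i. \<bar>q' $ i - q $ i\<bar> \<le> d" for q'
      using d[THEN spec[of _ q], THEN spec[of _ q']] q that \<open>p' < ?c q\<close> \<open>d > 0\<close> by simp
    with \<open>d > 0\<close> show ?thesis unfolding p_def by (intro exI[of _ d]) simp
  qed
  have upper: "\<exists>d>0. \<forall>q'. (\<forall>i. 0 < q' $ i \<and> q' $ i < 1) \<longrightarrow> (\<forall>i. \<bar>q' $ i - q $ i\<bar> \<le> d) \<longrightarrow> ?c q' \<le> ?c q + \<epsilon>"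
  proof (cases "1 \<le> ?c q + \<epsilon>")
    case True
    have "?c q' \<le> ?c q + \<epsilon>" if "\<forall>i. 0 < q' $ i \<and> q' $ i < 1" for q'
      using critical_prob_bounds(2)[OF meas, of q'] that True by force
    then show ?thesis by (intro exI[of _ 1]) simp
  next
    case False
    define p where "p = ?c q + \<epsilon> / 2"
    define p' where "p' = ?c q + \<epsilon>"
    have "0 < p" "p < p'" "p' \<le> 1" "?c q < p" using False c \<open>0 < \<epsilon>\<close> by (simp_all add: p_def p'_def)
    from transfer[OF this(1-3)] obtain d where "d > 0" and d: "\<forall>q1 q2. (\<forall>i. 0 < q1 $ i \<and> q1 $ i < 1 \<and> \<bar>q1 $ i - q $ i\<bar> \<le> d) \<longrightarrow>
      (\<forall>i. 0 < q2 $ i \<and> q2 $ i < 1 \<and> \<bar>q2 $ i - q $ i\<bar> \<le> d) \<longrightarrow> p' < ?c q1 \<longrightarrow> p \<le> ?c q2" by (elim exE conjE)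
    have "\<not> p' < ?c q'" if "\<forall>i. 0 < q' $ i \<and> q' $ i < 1" "\<forall>i. \<bar>q' $ i - q $ i\<bar> \<le> d" for q'
      using d[THEN spec[of _ q'], THEN spec[of _ q]] q that \<open>?c q < p\<close> \<open>d > 0\<close> by force
    with \<open>d > 0\<close> show ?thesis unfolding p'_def by (intro exI[of _ d]) (simp add: not_less)
  qed
  from lower upper obtain d1 d2 where d: "d1 > 0" "d2 > 0"
    "\<forall>q'. (\<forall>i. 0 < q' $ i \<and> q' $ i < 1) \<longrightarrow> (\<forall>i. \<bar>q' $ i - q $ i\<bar> \<le> d1) \<longrightarrow> ?c q - \<epsilon> \<le> ?c q'"
    "\<forall>q'. (\<forall>i. 0 < q' $ i \<and> q' $ i < 1) \<longrightarrow> (\<forall>i. \<bar>q' $ i - q $ i\<bar> \<le> d2) \<longrightarrow> ?c q' \<le> ?c q + \<epsilon>" by (elim exE conjE)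
  have "\<bar>?c q' - ?c q\<bar> \<le> \<epsilon>" if "\<forall>i. 0 < q' $ i \<and> q' $ i < 1" "\<forall>i. \<bar>q' $ i - q $ i\<bar> \<le> min d1 d2" for q'
    using d(3,4)[THEN spec[of _ q']] that by (simp add: abs_le_iff)
  then show ?thesis using d(1,2) by (intro exI[of _ "min d1 d2"]) simp
qed

text \<open>
  If the percolation event is not measurable, \<open>null_params q\<close> is empty for every \<open>q\<close>, and the critical
  parameter is constant because it is \<open>Sup {}\<close> throughout.
\<close>

lemma critical_prob_continuous:
  "continuous_on {q :: real ^ 'k. \<forall>i. 0 < q $ i \<and> q $ i < 1} (critical_prob V E u v)"
proof -
  let ?C = "{q :: real ^ 'k. \<forall>i. 0 < q $ i \<and> q $ i < 1}"
  have const: "continuous_on ?C (critical_prob V E u v)"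
    if "\<And>q. q \<in> ?C \<Longrightarrow> critical_prob V E u v q = c" for c
    by (rule continuous_on_eq[OF continuous_on_const]) (simp add: that)
  consider (nonmeas) "\<And>q p. percolation_event \<notin> sets (law q p)"
    | (fin) "\<And>q p. percolation_event \<in> sets (law q p)" "finite V"
    | (deg) x where "\<And>q p. percolation_event \<in> sets (law q p)" "infinite {b. {x, b} \<in> E}"
    | (main) "\<And>q p. percolation_event \<in> sets (law q p)" "\<And>a. finite {b. {a, b} \<in> E}" "infinite V"
    using sets_law by metis
  then show ?thesis
  proof cases
    case nonmeas
    then have "percolation_event \<notin> null_sets (law q p)" for q p by blast
    then show ?thesis by (intro const) (simp add: critical_prob_def)
  next
    case fin
    show ?thesis by (rule const, rule critical_prob_finite) (use fin in simp_all)
  next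
    case deg
    show ?thesis by (rule const, rule critical_prob_infinite_degree) (use deg in simp_all)
  next
    case main
    show ?thesis unfolding continuous_on_iff
    proof (intro ballI allI impI)
      fix q :: "real ^ 'k" and \<epsilon> :: real assume q: "q \<in> ?C" and "0 < \<epsilon>"
      have q': "0 < q $ i \<and> q $ i < 1" for i using q by simp
      from critical_prob_continuous_at[OF main q', of "\<epsilon> / 2"] \<open>0 < \<epsilon>\<close> obtain d where "d > 0" and
        d: "\<forall>q'. (\<forall>i. 0 < q' $ i \<and> q' $ i < 1) \<longrightarrow> (\<forall>i. \<bar>q' $ i - q $ i\<bar> \<le> d) \<longrightarrow>
          \<bar>critical_prob V E u v q' - critical_prob V E u v q\<bar> \<le> \<epsilon> / 2" by auto
      show "\<exists>d>0. \<forall>q'\<in>?C. dist q' q < d \<longrightarrow> dist (critical_prob V E u v q') (critical_prob V E u v q) < \<epsilon>"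
      proof (intro exI[of _ d] conjI ballI impI)
        fix q' assume q': "q' \<in> ?C" "dist q' q < d"
        have "\<bar>q' $ i - q $ i\<bar> \<le> d" for i
          using dist_vec_nth_le[of q' i q] q'(2) by (simp add: dist_real_def)
        with d q'(1) have "\<bar>critical_prob V E u v q' - critical_prob V E u v q\<bar> \<le> \<epsilon> / 2" by simp
        then show "dist (critical_prob V E u v q') (critical_prob V E u v q) < \<epsilon>"
          using \<open>0 < \<epsilon>\<close> by (simp add: dist_real_def)
      qed fact
    qed
  qed
qed

end

theorem theorem2:
  fixes V :: "'a set" and E :: "'a set set"
    and u v :: "'k::finite \<Rightarrow> 'a"
  assumes "connected_graph V E"
    and "\<And>i. {u i, v i} \<in> E"
    and "inj (\<lambda>i. {u i, v i})"
  shows "continuous_on {q :: real ^ 'k. \<forall>i. 0 < q $ i \<and> q $ i < 1} (critical_prob V E u v)"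
proof -
  interpret ladder_columns V E u v
    using assms by (rule ladder_columns.intro)
  show ?thesis by (rule critical_prob_continuous)
qed

end
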